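(* Let $\mathcal{M}$, $p$, $R$ be as in the context. There exists a constant $C>0$, independent of $t$ and $u$, such that for every sufficiently small $t>0$ and every $u\in L^2(\mathcal{M})$, $$\frac{C_t}{t}\int_{\mathcal{M}}\int_{\mathcal{M}}R\left(\frac{|\mathbf{x}-\mathbf{y}|^2}{4t}\right)(u(\mathbf{x})-u(\mathbf{y}))^2p(\mathbf{x})p(\mathbf{y})\,d\mu_{\mathbf{x}}\,d\mu_{\mathbf{y}}\ \ge\ C\int_{\mathcal{M}}|\nabla v(\mathbf{x})|^2p(\mathbf{x})\,d\mu_{\mathbf{x}},$$ where $$v(\mathbf{x})=\frac{C_t}{w_t(\mathbf{x})}\int_{\mathcal{M}}R\left(\frac{|\mathbf{x}-\mathbf{y}|^2}{4t}\right)u(\mathbf{y})p(\mathbf{y})\,d\mu_{\mathbf{y}},\qquad w_t(\mathbf{x})=C_t\int_{\mathcal{M}}R\left(\frac{|\mathbf{x}-\mathbf{y}|^2}{4t}\right)p(\mathbf{y})\,d\mu_{\mathbf{y}}.$$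
   Context: $\mathcal{M}$ is a compact $C^\infty$ smooth $k$-dimensional submanifold isometrically embedded in $\mathbb{R}^d$ with the Euclidean metric; its boundary $\partial\mathcal{M}$ is also compact and $C^\infty$ smooth. $d\mu$ denotes the volume measure and $\nabla$ the gradient on $\mathcal{M}$. The coefficient $p\in C^1(\mathcal{M})$ satisfies $0<c_0\le p(\mathbf{x})\le c_1<\infty$ for constants $c_0,c_1$. The kernel $R:[0,\infty)\to\mathbb{R}$ is $C^2$, $R(r)\ge0$ for all $r\ge0$, $R(r)=0$ for $r>1$, and there is $\delta_0>0$ with $R(r)\ge\delta_0$ for $0\le r\le\frac12$. The normalizing factor is $C_t=(4\pi t)^{-k/2}$. *)

theory Defs
  imports "HOL-Analysis.Analysis"
begin

text \<open>
  The dimensions \<open>k\<close> of the manifold and \<open>d\<close> of the ambient space are the cardinalities of the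
  index types \<open>'k\<close> and \<open>'d\<close>.  Notions that refer to \<open>k\<close> only through local parametrizations
  take an argument of type \<open>'k itself\<close>.
\<close>

subsection \<open>Smooth submanifolds with boundary\<close>

text \<open>
  Intended for open \<open>S\<close>.  All iterated directional derivatives of order at most \<open>n\<close> exist, are
  (Frechet) differentiable if of order less than \<open>n\<close>, and are continuous.
\<close>

primrec Ck_on :: "nat \<Rightarrow> 'a::euclidean_space set \<Rightarrow> ('a \<Rightarrow> 'b::euclidean_space) \<Rightarrow> bool" where
  "Ck_on 0 S f \<longleftrightarrow> continuous_on S f"
| "Ck_on (Suc n) S f \<longleftrightarrow> (\<forall>x\<in>S. f differentiable (at x)) \<and>
     (\<forall>h. Ck_on n S (\<lambda>x. frechet_derivative f (at x) h))"

definition smooth_on :: "'a::euclidean_space set \<Rightarrow> ('a \<Rightarrow> 'b::euclidean_space) \<Rightarrow> bool" where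
  "smooth_on S f \<longleftrightarrow> (\<forall>n. Ck_on n S f)"

definition half_space :: "'k::finite \<Rightarrow> (real^'k) set" where
  "half_space i = {z. 0 \<le> z $ i}"

text \<open>
  The chart domain is \<open>U \<inter> half_space i\<close>; interior charts are those for which \<open>U\<close> does not meet
  the hyperplane \<open>z $ i = 0\<close>.  Smoothness up to the boundary means that \<open>\<phi>\<close> is smooth on the open
  set \<open>U\<close>; at boundary points the derivative is determined by \<open>\<phi>\<close> on the half-space.
\<close>

definition local_parametrization ::
    "(real^'d::finite) set \<Rightarrow> 'k::finite \<Rightarrow> (real^'k) set \<Rightarrow> (real^'k \<Rightarrow> real^'d) \<Rightarrow> bool" where
  "local_parametrization M i U \<phi> \<longleftrightarrow>
     open U \<and> smooth_on U \<phi> \<and>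
     (\<forall>z\<in>U \<inter> half_space i. inj (frechet_derivative \<phi> (at z))) \<and>
     (\<exists>\<psi>. homeomorphism (U \<inter> half_space i) (\<phi> ` (U \<inter> half_space i)) \<phi> \<psi>) \<and>
     openin (top_of_set M) (\<phi> ` (U \<inter> half_space i))"

text \<open>
  The boundary of \<open>M\<close> consists of the points \<open>\<phi> z\<close> with \<open>z $ i = 0\<close>.  Restricting the
  parametrizations to this hyperplane shows that it is a smooth submanifold without boundary of
  dimension \<open>k - 1\<close>; it is closed in \<open>M\<close>, hence compact if \<open>M\<close> is.  So smoothness and compactness
  of the boundary are part of \<open>M\<close> being compact and a smooth submanifold with boundary.
\<close>

definition smooth_submanifold_with_boundary :: "'k::finite itself \<Rightarrow> (real^'d::finite) set \<Rightarrow> bool" where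
  "smooth_submanifold_with_boundary K M \<longleftrightarrow>
     (\<forall>x\<in>M. \<exists>(i::'k) U \<phi>. local_parametrization M i U \<phi> \<and> x \<in> \<phi> ` (U \<inter> half_space i))"

subsection \<open>Volume measure\<close>

text \<open>The Riemannian metric induced by the Euclidean one, in the coordinates given by \<open>\<phi>\<close>.\<close>

definition metric_matrix :: "(real^'k::finite \<Rightarrow> real^'d::finite) \<Rightarrow> real^'k \<Rightarrow> real^'k^'k" where
  "metric_matrix \<phi> z =
     (\<chi> i j. frechet_derivative \<phi> (at z) (axis i 1) \<bullet> frechet_derivative \<phi> (at z) (axis j 1))"

text \<open>
  The volume measure is the unique Borel measure on \<open>M\<close> that is \<open>sqrt (det g) dz\<close> in every local
  parametrization (uniqueness because countably many parametrized pieces cover \<open>M\<close>).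
\<close>

definition volume_measure_on ::
    "'k::finite itself \<Rightarrow> (real^'d::finite) set \<Rightarrow> (real^'d) measure \<Rightarrow> bool" where
  "volume_measure_on K M \<mu> \<longleftrightarrow>
     sets \<mu> = sets (restrict_space borel M) \<and>
     (\<forall>(i::'k) U \<phi>. local_parametrization M i U \<phi> \<longrightarrow>
        (\<forall>A\<in>sets \<mu>. A \<subseteq> \<phi> ` (U \<inter> half_space i) \<longrightarrow>
           emeasure \<mu> A =
             (\<integral>\<^sup>+z\<in>{z \<in> U \<inter> half_space i. \<phi> z \<in> A}. ennreal (sqrt (det (metric_matrix \<phi> z))) \<partial>lborel)))"

subsection \<open>Differential calculus on the manifold\<close>

text \<open>At a boundary point this is the full \<open>k\<close>-dimensional tangent space of \<open>M\<close>.\<close>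

definition tangent_space :: "'k::finite itself \<Rightarrow> (real^'d::finite) set \<Rightarrow> real^'d \<Rightarrow> (real^'d) set" where
  "tangent_space K M x =
     {\<tau>. \<exists>(i::'k) U \<phi> z. local_parametrization M i U \<phi> \<and> z \<in> U \<inter> half_space i \<and> \<phi> z = x \<and>
          \<tau> \<in> range (frechet_derivative \<phi> (at z))}"

definition manifold_gradient ::
    "'k::finite itself \<Rightarrow> (real^'d::finite) set \<Rightarrow> (real^'d \<Rightarrow> real) \<Rightarrow> real^'d \<Rightarrow> real^'d" where
  "manifold_gradient K M f x =
     (THE g. g \<in> tangent_space K M x \<and> (f has_derivative (\<lambda>h. g \<bullet> h)) (at x within M))"

definition C1_on_manifold ::
    "'k::finite itself \<Rightarrow> (real^'d::finite) set \<Rightarrow> (real^'d \<Rightarrow> real) \<Rightarrow> bool" where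
  "C1_on_manifold K M f \<longleftrightarrow>
     (\<forall>(i::'k) U \<phi>. local_parametrization M i U \<phi> \<longrightarrow>
        (\<exists>D :: real^'k \<Rightarrow> (real^'k) \<Rightarrow>\<^sub>L real.
           continuous_on (U \<inter> half_space i) D \<and>
           (\<forall>z\<in>U \<inter> half_space i.
              ((f \<circ> \<phi>) has_derivative blinfun_apply (D z)) (at z within U \<inter> half_space i))))"

subsection \<open>The kernel and the smoothed function\<close>

text \<open>One-sided derivatives at \<open>0\<close>; values at negative arguments are irrelevant.\<close>

definition C2_on_nonneg :: "(real \<Rightarrow> real) \<Rightarrow> bool" where
  "C2_on_nonneg R \<longleftrightarrow>
     (\<exists>R' R''. (\<forall>r\<ge>0. (R has_real_derivative R' r) (at r within {0..})) \<and>
               (\<forall>r\<ge>0. (R' has_real_derivative R'' r) (at r within {0..})) \<and>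
               continuous_on {0..} R'')"

definition norm_factor :: "'k::finite itself \<Rightarrow> real \<Rightarrow> real" where
  "norm_factor K t = (4 * pi * t) powr (- real CARD('k) / 2)"

definition weight_fun ::
    "'k::finite itself \<Rightarrow> (real^'d::finite) measure \<Rightarrow> (real \<Rightarrow> real) \<Rightarrow> (real^'d \<Rightarrow> real) \<Rightarrow>
     real \<Rightarrow> real^'d \<Rightarrow> real" where
  "weight_fun K \<mu> R p t x =
     norm_factor K t * (\<integral>y. R ((norm (x - y))\<^sup>2 / (4 * t)) * p y \<partial>\<mu>)"

definition smoothed_fun ::
    "'k::finite itself \<Rightarrow> (real^'d::finite) measure \<Rightarrow> (real \<Rightarrow> real) \<Rightarrow> (real^'d \<Rightarrow> real) \<Rightarrow>
     real \<Rightarrow> (real^'d \<Rightarrow> real) \<Rightarrow> real^'d \<Rightarrow> real" where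
  "smoothed_fun K \<mu> R p t u x =
     norm_factor K t / weight_fun K \<mu> R p t x *
       (\<integral>y. R ((norm (x - y))\<^sup>2 / (4 * t)) * u y * p y \<partial>\<mu>)"

end

theory Submission
  imports Defs
begin

text \<open>
  Write \<open>k\<close> for the dimension of \<open>M\<close> and \<open>s = sqrt t\<close>, and let
  \<open>E(\<rho>)\<close> be the integral of \<open>(u x - u y)\<^sup>2\<close> over the pairs at distance at most \<open>\<rho>\<close>.
  Up to constants, the left-hand side is at least \<open>E(7/5 s) / (t s^k)\<close>, because
  \<open>(7/5 s)\<^sup>2 / (4 t) < 1/2\<close>, so that the kernel is at least \<open>\<delta>0\<close> on these pairs
  (\<open>energy_lower_bound\<close>).

  The smoothed function \<open>v\<close> is a quotient of two integrals of the kernel.  Smoothing preserves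
  constants, so at a given point \<open>x\<close> its gradient does not change when \<open>u\<close> is replaced by
  \<open>u - u x\<close>.  The gradient of the kernel is at most of order \<open>1 / s\<close>, and the kernel
  vanishes beyond distance \<open>2 s\<close>; the normalizing weight is of order \<open>s^k\<close>.  Hence
  Cauchy--Schwarz bounds the square of the ambient gradient of \<open>v\<close> at \<open>x\<close> by a multiple of
  \<open>1 / (t s^k)\<close> times the integral of \<open>(u x - u y)\<^sup>2\<close> over \<open>dist x y \<le> 2 s\<close>
  (\<open>smoothed_gradient_bound\<close>).  The gradient on \<open>M\<close> is the orthogonal projection of the ambient
  one to the tangent space, hence not longer (\<open>norm_manifold_gradient_le\<close>).  So the right-hand side
  is at most of order \<open>E(2 s) / (t s^k)\<close>.

  It remains to bound \<open>E(2 s)\<close> by \<open>E(7/5 s)\<close>, although the support of the kernel may reach further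
  than the region where it is known to be positive.  This is a chaining argument
  (\<open>chaining\<close>): two points at distance at most \<open>2 s\<close> have an approximate midpoint in
  \<open>M\<close>, and every point \<open>z\<close> within \<open>s / 5\<close> of it is within \<open>7/5 s\<close> of both.  One
  averages \<open>(u x - u y)\<^sup>2 \<le> 2 (u x - u z)\<^sup>2 + 2 (u z - u y)\<^sup>2\<close> over these \<open>z\<close>.

  The geometry enters only through two facts that hold uniformly at small scales
  (\<open>volume_regularity_and_midpoints\<close>): balls of radius \<open>\<rho>\<close> have volume comparable to
  \<open>\<rho>^k\<close>, and approximate midpoints exist.  Both hold because a chart is close to an injective
  linear map near a given point and because its domain, a piece of a half-space, contains midpoints
  and also a cube at each of its points.
\<close>

section \<open>Charts are nearly linear\<close>

lemma smooth_on_imp_differentiable: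
  assumes "smooth_on U \<phi>" "z \<in> U"
  shows "(\<phi> has_derivative frechet_derivative \<phi> (at z)) (at z)"
proof -
  have "Ck_on (Suc 0) U \<phi>" using assms(1) by (auto simp: smooth_on_def)
  with assms(2) show ?thesis by (simp add: frechet_derivative_works)
qed

lemma smooth_on_imp_continuous_derivative:
  assumes "smooth_on U \<phi>"
  shows "continuous_on U (\<lambda>z. frechet_derivative \<phi> (at z) h)"
proof -
  have "Ck_on (Suc 0) U \<phi>" using assms(1) by (auto simp: smooth_on_def)
  then show ?thesis by simp
qed

text \<open>
  Strict differentiability: by the mean value inequality it suffices that the derivative varies
  little near \<open>z0\<close> in operator norm, which follows from the continuity of its values on the finitely
  many basis vectors.
\<close>
lemma smooth_on_almost_linear:
  fixes \<phi> :: "'a::euclidean_space \<Rightarrow> 'b::euclidean_space"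
  assumes "open U" "smooth_on U \<phi>" "z0 \<in> U" "0 < \<epsilon>"
  obtains \<delta> where "0 < \<delta>" "ball z0 \<delta> \<subseteq> U"
    "\<And>a b. a \<in> ball z0 \<delta> \<Longrightarrow> b \<in> ball z0 \<delta> \<Longrightarrow>
       norm (\<phi> b - \<phi> a - frechet_derivative \<phi> (at z0) (b - a)) \<le> \<epsilon> * norm (b - a)"
proof -
  let ?D = "\<lambda>z. frechet_derivative \<phi> (at z)"
  have "\<forall>e\<in>Basis. \<forall>\<^sub>F z in at z0. norm (?D z e - ?D z0 e) < \<epsilon> / DIM('a)"
  proof
    fix e :: 'a
    have "isCont (\<lambda>z. ?D z e) z0"
      using smooth_on_imp_continuous_derivative[OF assms(2)] assms(1,3) continuous_on_eq_continuous_at by blast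
    then have "((\<lambda>z. ?D z e) \<longlongrightarrow> ?D z0 e) (at z0)" by (simp add: isCont_def)
    then show "\<forall>\<^sub>F z in at z0. norm (?D z e - ?D z0 e) < \<epsilon> / DIM('a)"
      using assms(4) unfolding tendsto_iff dist_norm by (auto simp: DIM_positive)
  qed
  then have "\<forall>\<^sub>F z in at z0. \<forall>e\<in>Basis. norm (?D z e - ?D z0 e) < \<epsilon> / DIM('a)"
    by (simp add: eventually_ball_finite)
  then obtain \<delta>1 where \<delta>1: "0 < \<delta>1"
    "\<And>z e. z \<noteq> z0 \<Longrightarrow> dist z z0 < \<delta>1 \<Longrightarrow> e \<in> Basis \<Longrightarrow> norm (?D z e - ?D z0 e) < \<epsilon> / DIM('a)"
    unfolding eventually_at by auto
  obtain \<delta>2 where \<delta>2: "0 < \<delta>2" "ball z0 \<delta>2 \<subseteq> U" using assms(1,3) openE by blast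
  define \<delta> where "\<delta> = min \<delta>1 \<delta>2"
  have sub: "ball z0 \<delta> \<subseteq> U" using \<delta>2 by (auto simp: \<delta>_def)
  have lin: "linear (?D z)" if "z \<in> U" for z
    using smooth_on_imp_differentiable[OF assms(2) that] has_derivative_linear by blast
  have on: "onorm (\<lambda>h. ?D z h - ?D z0 h) \<le> \<epsilon>" if z: "z \<in> ball z0 \<delta>" for z
  proof (rule onorm_le)
    fix h :: 'a
    have zU: "z \<in> U" using z sub by auto
    let ?E = "\<lambda>h. ?D z h - ?D z0 h"
    have linE: "linear ?E" using lin[OF zU] lin[OF assms(3)] by (simp add: linear_compose_sub)
    have "?E h = ?E (\<Sum>e\<in>Basis. (h \<bullet> e) *\<^sub>R e)" by (simp add: euclidean_representation)
    also have "\<dots> = (\<Sum>e\<in>Basis. (h \<bullet> e) *\<^sub>R ?E e)"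
      by (subst linear_sum[OF linE]) (simp add: linear_scale[OF linE, simplified])
    also have "norm \<dots> \<le> (\<Sum>e\<in>(Basis::'a set). norm h * (\<epsilon> / DIM('a)))"
    proof (rule order_trans[OF norm_sum], rule sum_mono)
      fix e :: 'a assume e: "e \<in> Basis"
      have "norm (?E e) \<le> \<epsilon> / DIM('a)"
        using \<delta>1(2)[of z e] z e assms(4) by (cases "z = z0") (auto simp: \<delta>_def dist_commute less_imp_le)
      then show "norm ((h \<bullet> e) *\<^sub>R ?E e) \<le> norm h * (\<epsilon> / DIM('a))"
        using Basis_le_norm[OF e, of h] unfolding norm_scaleR by (intro mult_mono) auto
    qed
    also have "\<dots> = \<epsilon> * norm h" by simp
    finally show "norm (?E h) \<le> \<epsilon> * norm h" .
  qed
  show thesis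
  proof (rule that[of \<delta>])
    show "0 < \<delta>" using \<delta>1 \<delta>2 by (auto simp: \<delta>_def)
    fix a b assume ab: "a \<in> ball z0 \<delta>" "b \<in> ball z0 \<delta>"
    have "norm (\<phi> b - \<phi> a - ?D z0 (b - a)) \<le> norm (b - a) * \<epsilon>"
    proof (rule differentiable_bound_linearization[where S="ball z0 \<delta>" and f'="?D"])
      fix t :: real assume "t \<in> {0..1}"
      then show "a + t *\<^sub>R (b - a) \<in> ball z0 \<delta>"
        using convexD[OF convex_ball, of a z0 \<delta> b "1-t" t] ab by (simp add: algebra_simps)
    next
      fix z assume "z \<in> ball z0 \<delta>"
      then show "(\<phi> has_derivative ?D z) (at z within ball z0 \<delta>)"
        using smooth_on_imp_differentiable[OF assms(2)] sub has_derivative_at_withinI by blast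
    qed (use on \<open>0 < \<delta>\<close> in \<open>auto simp: fun_diff_def\<close>)
    then show "norm (\<phi> b - \<phi> a - ?D z0 (b - a)) \<le> \<epsilon> * norm (b - a)" by (simp add: mult.commute)
  qed (fact sub)
qed

lemma continuous_on_det_matrix:
  fixes G :: "'a::topological_space \<Rightarrow> real^'n^'n"
  assumes "\<And>i j. continuous_on S (\<lambda>x. G x $ i $ j)"
  shows "continuous_on S (\<lambda>x. det (G x))"
  unfolding det_def by (intro continuous_intros assms)

text \<open>
  Moving from the identity to \<open>G\<close> along a segment, the matrix stays positive definite, so its
  determinant never vanishes and keeps the sign that it has at the identity.
\<close>
lemma det_positive_definite:
  fixes G :: "real^'n^'n"
  assumes "\<And>w. w \<noteq> 0 \<Longrightarrow> 0 < w \<bullet> (G *v w)"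
  shows "0 < det G"
proof (rule ccontr)
  let ?P = "\<lambda>s::real. (1 - s) *\<^sub>R mat 1 + s *\<^sub>R G"
  assume neg: "\<not> 0 < det G"
  have c: "continuous_on {0..1} (\<lambda>s. det (?P s))"
    by (intro continuous_on_det_matrix) (auto intro!: continuous_intros)
  have "\<exists>s\<ge>0. s \<le> 1 \<and> det (?P s) = 0"
    by (rule IVT2') (use neg c in \<open>auto\<close>)
  then obtain s where s: "0 \<le> s" "s \<le> 1" "det (?P s) = 0" by blast
  then have "\<not> invertible (?P s)" by (simp add: invertible_det_nz)
  then obtain w where w: "?P s *v w = 0" "w \<noteq> 0"
    using matrix_left_invertible_ker invertible_left_inverse by blast
  have "?P s *v w = (1 - s) *\<^sub>R w + s *\<^sub>R (G *v w)"
    by (simp add: matrix_vector_mult_add_rdistrib scaleR_matrix_vector_assoc[symmetric])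
  then have "0 = w \<bullet> ((1 - s) *\<^sub>R w + s *\<^sub>R (G *v w))" using w(1) by simp
  also have "\<dots> = (1 - s) * (w \<bullet> w) + s * (w \<bullet> (G *v w))" by (simp add: inner_add_right)
  finally have "(1 - s) * (w \<bullet> w) + s * (w \<bullet> (G *v w)) = 0" by simp
  moreover have "0 < w \<bullet> w" "0 < w \<bullet> (G *v w)" using w(2) assms by auto
  moreover have "0 < (1 - s) * (w \<bullet> w) + s * (w \<bullet> (G *v w))"
  proof (cases "s = 1")
    case False
    then have "0 < (1 - s) * (w \<bullet> w)" using s \<open>0 < w \<bullet> w\<close> by simp
    moreover have "0 \<le> s * (w \<bullet> (G *v w))" using s \<open>0 < w \<bullet> (G *v w)\<close> by simp
    ultimately show ?thesis by linarith
  qed (use \<open>0 < w \<bullet> (G *v w)\<close> in simp)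
  ultimately show False by simp
qed

text \<open>
  The metric matrix is the Gram matrix of the partial derivatives, so its quadratic form is the
  squared norm of the image of \<open>w\<close> under the derivative.
\<close>
lemma det_metric_matrix_pos:
  fixes \<phi> :: "real^'k \<Rightarrow> real^'d"
  assumes lin: "linear (frechet_derivative \<phi> (at z))" and inj: "inj (frechet_derivative \<phi> (at z))"
  shows "0 < det (metric_matrix \<phi> z)"
proof (rule det_positive_definite)
  fix w :: "real^'k" assume w: "w \<noteq> 0"
  let ?A = "frechet_derivative \<phi> (at z)"
  have "?A w = ?A (\<Sum>i\<in>UNIV. w $ i *\<^sub>R axis i 1)"
    by (metis basis_expansion scalar_mult_eq_scaleR)
  also have "\<dots> = (\<Sum>i\<in>UNIV. w $ i *\<^sub>R ?A (axis i 1))"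
    by (simp add: linear_sum[OF lin] linear_scale[OF lin])
  finally have Aw: "?A w = (\<Sum>i\<in>UNIV. w $ i *\<^sub>R ?A (axis i 1))" .
  have "w \<bullet> (metric_matrix \<phi> z *v w) = ?A w \<bullet> ?A w"
    unfolding Aw
    by (simp add: inner_vec_def[of w] matrix_vector_mult_def metric_matrix_def inner_sum_left inner_sum_right
        sum_distrib_left mult.assoc mult.commute mult.left_commute inner_commute)
  moreover have "?A w \<noteq> 0" using inj lin w linear_injective_0 by blast
  ultimately show "0 < w \<bullet> (metric_matrix \<phi> z *v w)" by simp
qed

lemma emeasure_lborel_cube:
  fixes a :: "real^'k"
  assumes "0 \<le> \<sigma>"
  shows "emeasure lborel (cbox a (\<chi> i. a $ i + \<sigma>)) = ennreal (\<sigma> ^ CARD('k))"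
proof -
  have "cbox a (\<chi> i. a $ i + \<sigma>) \<noteq> {}" using assms by (auto simp: interval_ne_empty_cart)
  then have "measure lborel (cbox a (\<chi> i. a $ i + \<sigma>)) = \<sigma> ^ CARD('k)"
    by (subst content_cbox_cart) auto
  moreover have "emeasure lborel (cbox a (\<chi> i. a $ i + \<sigma>)) < \<infinity>"
    by (rule emeasure_bounded_finite[OF bounded_cbox])
  ultimately show ?thesis by (metis emeasure_eq_ennreal_measure infinity_ennreal_def less_irrefl)
qed

lemma chart_image_contains_ball:
  assumes chart: "local_parametrization M i U \<phi>" and z0: "z0 \<in> U \<inter> half_space i" and "0 < \<eta>"
  obtains \<rho> where "0 < \<rho>" "M \<inter> ball (\<phi> z0) \<rho> \<subseteq> \<phi> ` (U \<inter> half_space i \<inter> ball z0 \<eta>)"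
proof -
  let ?D = "U \<inter> half_space i"
  obtain \<psi> where hom: "homeomorphism ?D (\<phi> ` ?D) \<phi> \<psi>"
    and oM: "openin (top_of_set M) (\<phi> ` ?D)"
    using chart unfolding local_parametrization_def by blast
  have "openin (top_of_set ?D) (?D \<inter> ball z0 \<eta>)" by (simp add: openin_open_Int)
  then have "openin (top_of_set (\<phi> ` ?D)) (\<phi> ` (?D \<inter> ball z0 \<eta>))"
    using homeomorphism_imp_open_map[OF hom] by blast
  then have "openin (top_of_set M) (\<phi> ` (?D \<inter> ball z0 \<eta>))" using oM openin_trans by blast
  moreover have "\<phi> z0 \<in> \<phi> ` (?D \<inter> ball z0 \<eta>)" using z0 \<open>0 < \<eta>\<close> by auto
  ultimately obtain \<rho> where "0 < \<rho>" "ball (\<phi> z0) \<rho> \<inter> M \<subseteq> \<phi> ` (?D \<inter> ball z0 \<eta>)"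
    unfolding openin_contains_ball by meson
  then show thesis using that by (metis inf_commute)
qed

lemma chart_maps_into: "local_parametrization M i U \<phi> \<Longrightarrow> z \<in> U \<inter> half_space i \<Longrightarrow> \<phi> z \<in> M"
  unfolding local_parametrization_def using openin_imp_subset by blast

lemma chart_inj_on: "local_parametrization M i U \<phi> \<Longrightarrow> inj_on \<phi> (U \<inter> half_space i)"
  unfolding local_parametrization_def homeomorphism_def inj_on_def by metis

text \<open>
  If the error of the linear approximation is a small multiple of the lower bound of the derivative,
  the chart distorts distances by bounded factors and maps midpoints to approximate midpoints.  The
  factor \<open>3/5\<close> leaves room for the chaining step, where \<open>3/5 * 2 + 1/5 = 7/5\<close> has to stay below
  \<open>sqrt 2\<close>.
\<close>
lemma chart_quasi_isometry:
  fixes \<phi> :: "real^'k::finite \<Rightarrow> real^'d::finite"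
  assumes chart: "local_parametrization M i U \<phi>" and z0: "z0 \<in> U \<inter> half_space i"
  obtains \<delta> b L where "0 < \<delta>" "ball z0 \<delta> \<subseteq> U" "0 < b" "0 < L"
    "\<And>a a'. a \<in> ball z0 \<delta> \<Longrightarrow> a' \<in> ball z0 \<delta> \<Longrightarrow> b * norm (a' - a) \<le> norm (\<phi> a' - \<phi> a)"
    "\<And>a a'. a \<in> ball z0 \<delta> \<Longrightarrow> a' \<in> ball z0 \<delta> \<Longrightarrow> norm (\<phi> a' - \<phi> a) \<le> L * norm (a' - a)"
    "\<And>a a'. a \<in> ball z0 \<delta> \<Longrightarrow> a' \<in> ball z0 \<delta> \<Longrightarrow>
       norm (\<phi> (midpoint a a') - \<phi> a) \<le> 3/5 * norm (\<phi> a' - \<phi> a)"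
proof -
  let ?A = "frechet_derivative \<phi> (at z0)"
  have sm: "open U" "smooth_on U \<phi>" "inj ?A" "z0 \<in> U"
    using chart z0 unfolding local_parametrization_def by auto
  have bl: "bounded_linear ?A"
    using smooth_on_imp_differentiable[OF sm(2,4)] has_derivative_bounded_linear by blast
  then have lin: "linear ?A" by (simp add: bounded_linear.linear)
  obtain c where c: "0 < c" "\<And>h. c * norm h \<le> norm (?A h)"
    using linear_inj_bounded_below_pos[OF lin sm(3)] by blast
  obtain B where B: "0 < B" "\<And>h. norm (?A h) \<le> norm h * B"
    using bounded_linear.pos_bounded[OF bl] by blast
  \<comment> \<open>With error \<open>c / 11\<close> the lower bound drops to \<open>10/11 * c\<close>, so the error is a tenth of the
    distance of the images; half the distance plus this tenth gives \<open>3/5\<close>.\<close>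
  define \<epsilon> where "\<epsilon> = c / 11"
  have e: "0 < \<epsilon>" using c by (simp add: \<epsilon>_def)
  obtain \<delta> where d: "0 < \<delta>" "ball z0 \<delta> \<subseteq> U"
    and lz: "\<And>a a'. a \<in> ball z0 \<delta> \<Longrightarrow> a' \<in> ball z0 \<delta> \<Longrightarrow>
       norm (\<phi> a' - \<phi> a - ?A (a' - a)) \<le> \<epsilon> * norm (a' - a)"
    using smooth_on_almost_linear[OF sm(1,2,4) e] by metis
  have low: "10/11 * c * norm (a' - a) \<le> norm (\<phi> a' - \<phi> a)"
    if "a \<in> ball z0 \<delta>" "a' \<in> ball z0 \<delta>" for a a'
  proof -
    have "c * norm (a' - a) \<le> norm (?A (a' - a))" by (rule c)
    also have "\<dots> \<le> norm (\<phi> a' - \<phi> a) + norm (\<phi> a' - \<phi> a - ?A (a' - a))"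
      by norm
    also have "\<dots> \<le> norm (\<phi> a' - \<phi> a) + c/11 * norm (a' - a)"
      using lz[OF that] by (simp add: \<epsilon>_def)
    finally show ?thesis by (simp add: algebra_simps)
  qed
  show thesis
  proof (rule that[OF d, of "10/11 * c" "B + \<epsilon>"])
    fix a a' assume aa: "a \<in> ball z0 \<delta>" "a' \<in> ball z0 \<delta>"
    show "10/11 * c * norm (a' - a) \<le> norm (\<phi> a' - \<phi> a)" by (rule low[OF aa])
    have "norm (\<phi> a' - \<phi> a) \<le> norm (?A (a' - a)) + norm (\<phi> a' - \<phi> a - ?A (a' - a))"
      by norm
    then show "norm (\<phi> a' - \<phi> a) \<le> (B + \<epsilon>) * norm (a' - a)"
      using lz[OF aa] B(2)[of "a' - a"] by (simp add: algebra_simps)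
    let ?m = "midpoint a a'"
    have m: "?m \<in> ball z0 \<delta>"
      using convexD[OF convex_ball, of a z0 \<delta> a' "1/2" "1/2"] aa
      by (simp add: midpoint_def scaleR_add_right)
    have ma: "?m - a = (1/2) *\<^sub>R (a' - a)"
    proof -
      have "a = (1/2) *\<^sub>R a + (1/2) *\<^sub>R a" by (simp flip: scaleR_add_left)
      then show ?thesis by (simp add: midpoint_def algebra_simps)
    qed
    have 1: "norm (\<phi> ?m - \<phi> a - (1/2) *\<^sub>R ?A (a' - a)) \<le> \<epsilon> * (norm (a' - a) / 2)"
      using lz[OF aa(1) m] unfolding ma by (simp add: linear_scale[OF lin])
    have 2: "norm ((1/2) *\<^sub>R (\<phi> a' - \<phi> a) - (1/2) *\<^sub>R ?A (a' - a)) \<le> \<epsilon> * (norm (a' - a) / 2)"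
      using lz[OF aa] by (simp flip: scaleR_diff_right)
    have "norm (\<phi> ?m - \<phi> a)
        \<le> norm ((1/2) *\<^sub>R (\<phi> a' - \<phi> a)) + \<epsilon> * (norm (a' - a) / 2) + \<epsilon> * (norm (a' - a) / 2)"
    proof -
      have tri: "norm P \<le> norm R + q + q" if "norm (P - Q) \<le> q" "norm (R - Q) \<le> q"
        for P Q R :: "real^'d" and q :: real
        using that by norm
      show ?thesis using 1 2 by (rule tri)
    qed
    also have "\<dots> = norm (\<phi> a' - \<phi> a) / 2 + \<epsilon> * norm (a' - a)" by simp
    also have "\<epsilon> * norm (a' - a) \<le> 1/10 * norm (\<phi> a' - \<phi> a)"
      using low[OF aa] by (simp add: \<epsilon>_def)
    finally show "norm (\<phi> ?m - \<phi> a) \<le> 3/5 * norm (\<phi> a' - \<phi> a)" by simp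
  qed (use c B e in auto)
qed

text \<open>
  The density is continuous and positive at \<open>z0\<close>, so it varies at most by a factor of two nearby.
\<close>
lemma chart_density_bounds:
  fixes \<phi> :: "real^'k::finite \<Rightarrow> real^'d::finite"
  assumes chart: "local_parametrization M i U \<phi>" and z0: "z0 \<in> U \<inter> half_space i"
  obtains \<eta> g where "0 < \<eta>" "0 < g"
    "\<And>z. z \<in> ball z0 \<eta> \<Longrightarrow> g \<le> sqrt (det (metric_matrix \<phi> z)) \<and> sqrt (det (metric_matrix \<phi> z)) \<le> 2 * g"
proof -
  have sm: "open U" "smooth_on U \<phi>" "inj (frechet_derivative \<phi> (at z0))" "z0 \<in> U"
    using chart z0 unfolding local_parametrization_def by auto
  have lin: "linear (frechet_derivative \<phi> (at z0))"
    using smooth_on_imp_differentiable[OF sm(2,4)] has_derivative_linear by blast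
  let ?g = "\<lambda>z. sqrt (det (metric_matrix \<phi> z))"
  have "continuous_on U ?g"
    by (intro continuous_on_real_sqrt continuous_on_det_matrix)
      (simp add: metric_matrix_def continuous_on_inner smooth_on_imp_continuous_derivative[OF sm(2)])
  then have c: "isCont ?g z0" using sm continuous_on_eq_continuous_at by blast
  have pos: "0 < ?g z0" using det_metric_matrix_pos[OF lin sm(3)] by simp
  obtain \<eta>1 where 1: "0 < \<eta>1" "\<And>z. dist z z0 < \<eta>1 \<Longrightarrow> dist (?g z) (?g z0) < ?g z0 / 3"
    using c pos unfolding continuous_at_eps_delta by (meson divide_pos_pos zero_less_numeral)
  show thesis
  proof (rule that[of \<eta>1 "2/3 * ?g z0"])
    fix z assume "z \<in> ball z0 \<eta>1"
    then have "dist (?g z) (?g z0) < ?g z0 / 3" by (intro 1(2)) (simp add: dist_commute)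
    then have "?g z < ?g z0 + ?g z0 / 3" "?g z0 - ?g z0 / 3 < ?g z"
      unfolding dist_real_def by linarith+
    then show "2/3 * ?g z0 \<le> ?g z \<and> ?g z \<le> 2 * (2/3 * ?g z0)" by linarith
  qed (use 1 pos in auto)
qed

section \<open>Volumes of balls and approximate midpoints\<close>

lemma volume_of_chart_set:
  assumes vol: "volume_measure_on TYPE('k::finite) M \<mu>" and chart: "local_parametrization M (i::'k) U \<phi>"
    and "A \<in> sets \<mu>" "A \<subseteq> \<phi> ` (U \<inter> half_space i)"
  shows "emeasure \<mu> A =
    (\<integral>\<^sup>+z\<in>{z \<in> U \<inter> half_space i. \<phi> z \<in> A}. ennreal (sqrt (det (metric_matrix \<phi> z))) \<partial>lborel)"
  using assms unfolding volume_measure_on_def by blast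

lemma sets_volume_measure:
  "volume_measure_on K M \<mu> \<Longrightarrow> sets \<mu> = sets (restrict_space borel M)"
  by (simp add: volume_measure_on_def)

lemma space_volume_measure: "volume_measure_on K M \<mu> \<Longrightarrow> space \<mu> = M"
  using sets_eq_imp_space_eq[OF sets_volume_measure] by (auto simp: space_restrict_space)

lemma cball_in_sets_volume_measure:
  "volume_measure_on K M \<mu> \<Longrightarrow> M \<inter> cball x s \<in> sets \<mu>"
  by (auto simp: sets_volume_measure sets_restrict_space)

text \<open>
  In coordinates a small ball contains a cube and is contained in a cube, both with sides
  proportional to \<open>s\<close>.  The inner cube has its corner at the centre and extends in the directions of
  the positive axes, so that it stays in the half-space at boundary points as well.
\<close>
lemma local_ball_volume_bounds:
  fixes M :: "(real^'d::finite) set"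
  assumes vol: "volume_measure_on TYPE('k::finite) M \<mu>" and chart: "local_parametrization M (i::'k) U \<phi>"
    and z0: "z0 \<in> U \<inter> half_space i"
  obtains r c C where "0 < r" "0 < c" "0 < C"
    "\<And>x s. x \<in> M \<inter> ball (\<phi> z0) r \<Longrightarrow> 0 \<le> s \<Longrightarrow> s < r \<Longrightarrow>
       ennreal (c * s ^ CARD('k)) \<le> emeasure \<mu> (M \<inter> cball x s) \<and>
       emeasure \<mu> (M \<inter> cball x s) \<le> ennreal (C * s ^ CARD('k))"
proof -
  let ?k = "CARD('k)" and ?D = "U \<inter> half_space i"
  let ?dens = "\<lambda>z. sqrt (det (metric_matrix \<phi> z))"
  obtain \<delta> b L where q: "0 < \<delta>" "ball z0 \<delta> \<subseteq> U" "0 < b" "0 < L"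
    "\<And>a a'. a \<in> ball z0 \<delta> \<Longrightarrow> a' \<in> ball z0 \<delta> \<Longrightarrow> b * norm (a' - a) \<le> norm (\<phi> a' - \<phi> a)"
    "\<And>a a'. a \<in> ball z0 \<delta> \<Longrightarrow> a' \<in> ball z0 \<delta> \<Longrightarrow> norm (\<phi> a' - \<phi> a) \<le> L * norm (a' - a)"
    by (rule chart_quasi_isometry[OF chart z0]) blast
  obtain \<eta> g where e: "0 < \<eta>" "0 < g"
    "\<And>z. z \<in> ball z0 \<eta> \<Longrightarrow> g \<le> ?dens z \<and> ?dens z \<le> 2 * g"
    by (rule chart_density_bounds[OF chart z0]) blast
  \<comment> \<open>Half of the smaller radius: points within \<open>\<theta>\<close> of a point in \<open>ball z0 \<theta>\<close> are still in both
    neighbourhoods.\<close>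
  define \<theta> where "\<theta> = min \<delta> \<eta> / 2"
  have th: "0 < \<theta>" "2 * \<theta> \<le> \<delta>" "2 * \<theta> \<le> \<eta>" using q e by (auto simp: \<theta>_def)
  obtain \<rho> where \<rho>: "0 < \<rho>" "M \<inter> ball (\<phi> z0) \<rho> \<subseteq> \<phi> ` (?D \<inter> ball z0 \<theta>)"
    using chart_image_contains_ball[OF chart z0 th(1)] by blast
  define r where "r = min (\<rho> / 2) (\<theta> * L)"
  have r: "0 < r" "2 * r \<le> \<rho>" "r \<le> \<theta> * L" using \<rho> th q by (auto simp: r_def)
  define c where "c = g * (1 / (L * ?k)) ^ ?k"
  define C where "C = 2 * g * (2 / b) ^ ?k"
  show thesis
  proof (rule that[of r c C])
    show "0 < c" "0 < C" using e q by (auto simp: c_def C_def)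
    fix x s assume x: "x \<in> M \<inter> ball (\<phi> z0) r" and s: "0 \<le> (s::real)" "s < r"
    have "x \<in> M \<inter> ball (\<phi> z0) \<rho>" using x r by auto
    then obtain a where a: "x = \<phi> a" "a \<in> ?D" "a \<in> ball z0 \<theta>" using \<rho> by blast
    let ?A = "M \<inter> cball x s"
    have sub: "?A \<subseteq> \<phi> ` (?D \<inter> ball z0 \<theta>)"
    proof -
      have "cball x s \<subseteq> ball (\<phi> z0) \<rho>"
      proof
        fix y assume "y \<in> cball x s"
        then show "y \<in> ball (\<phi> z0) \<rho>"
          using x s r dist_triangle[of "\<phi> z0" y x] by auto
      qed
      then show ?thesis using \<rho> by blast
    qed
    have vA: "emeasure \<mu> ?A = (\<integral>\<^sup>+z\<in>{z \<in> ?D. \<phi> z \<in> ?A}. ennreal (?dens z) \<partial>lborel)"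
      using volume_of_chart_set[OF vol chart cball_in_sets_volume_measure[OF vol]] sub by blast
    have pre: "z \<in> ball z0 \<theta>" if "z \<in> ?D" "\<phi> z \<in> ?A" for z
    proof -
      have "\<phi> z \<in> \<phi> ` (?D \<inter> ball z0 \<theta>)" using sub that(2) by (rule subsetD)
      then obtain z' where "\<phi> z = \<phi> z'" "z' \<in> ?D \<inter> ball z0 \<theta>" by (rule imageE)
      then show ?thesis using inj_onD[OF chart_inj_on[OF chart]] that by auto
    qed
    have big: "z \<in> ball z0 \<delta>" "z \<in> ball z0 \<eta>" if "dist z0 z < 2 * \<theta>" for z
      using that th by auto
    show "ennreal (c * s ^ ?k) \<le> emeasure \<mu> ?A \<and> emeasure \<mu> ?A \<le> ennreal (C * s ^ ?k)"
    proof
      define \<sigma> where "\<sigma> = s / (L * ?k)"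
      let ?Q = "cbox a (\<chi> j. a $ j + \<sigma>)"
      have \<sigma>: "0 \<le> \<sigma>" using s q by (simp add: \<sigma>_def)
      have Q: "z \<in> ?D \<and> \<phi> z \<in> ?A \<and> z \<in> ball z0 \<eta>" if z: "z \<in> ?Q" for z
      proof -
        have zj: "a $ j \<le> z $ j" "z $ j \<le> a $ j + \<sigma>" for j
          using z by (auto simp: mem_box_cart)
        have "norm (z - a) \<le> (\<Sum>j\<in>UNIV. \<bar>(z - a) $ j\<bar>)" by (rule norm_le_l1_cart)
        also have "\<dots> \<le> (\<Sum>j\<in>(UNIV::'k set). \<sigma>)"
          by (rule sum_mono) (use zj in \<open>simp add: algebra_simps\<close>)
        also have "\<dots> = s / L" by (simp add: \<sigma>_def)
        finally have nz: "norm (z - a) \<le> s / L" .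
        also have "s / L < \<theta>" using s r q by (simp add: divide_less_eq)
        finally have "dist z0 z < 2 * \<theta>"
          using a(3) dist_triangle[of z0 z a] by (simp add: dist_norm norm_minus_commute)
        note b = big[OF this]
        have "a \<in> ball z0 \<delta>" using a(3) th by auto
        then have "norm (\<phi> z - \<phi> a) \<le> L * norm (z - a)" using q(6) b(1) by blast
        also have "\<dots> \<le> s" using nz q(4) by (simp add: pos_le_divide_eq mult.commute)
        finally have "\<phi> z \<in> cball x s" using a(1) by (simp add: dist_norm norm_minus_commute)
        moreover have "z \<in> ?D"
          using b(1) q(2) zj(1)[of i] a(2) by (auto simp: half_space_def)
        ultimately show ?thesis using b chart_maps_into[OF chart] by blast
      qed
      have "ennreal (c * s ^ ?k) = ennreal g * emeasure lborel ?Q"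
      proof -
        have "c * s ^ ?k = g * \<sigma> ^ ?k" by (simp add: c_def \<sigma>_def power_divide)
        then show ?thesis using e(2) \<sigma> by (simp add: emeasure_lborel_cube ennreal_mult)
      qed
      also have "\<dots> = (\<integral>\<^sup>+z\<in>?Q. ennreal g \<partial>lborel)" by (simp add: nn_integral_cmult_indicator)
      also have "\<dots> \<le> emeasure \<mu> ?A" unfolding vA
        by (intro nn_integral_mono) (use Q e(3) in \<open>auto simp: indicator_def intro!: ennreal_leI\<close>)
      finally show "ennreal (c * s ^ ?k) \<le> emeasure \<mu> ?A" .
    next
      define \<sigma> where "\<sigma> = 2 * s / b"
      define a' :: "real^'k" where "a' = (\<chi> j. a $ j - s / b)"
      let ?Q = "cbox a' (\<chi> j. a' $ j + \<sigma>)"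
      have \<sigma>: "0 \<le> \<sigma>" using s q by (simp add: \<sigma>_def)
      have Q: "z \<in> ?Q" "?dens z \<le> 2 * g" if z: "z \<in> ?D" "\<phi> z \<in> ?A" for z
      proof -
        have zb: "z \<in> ball z0 \<theta>" using pre z by blast
        then have "z \<in> ball z0 \<delta>" "a \<in> ball z0 \<delta>" using a(3) th by auto
        then have "b * norm (z - a) \<le> norm (\<phi> z - \<phi> a)" using q by blast
        also have "\<dots> \<le> s" using z a by (simp add: dist_norm norm_minus_commute)
        finally have "norm (z - a) \<le> s / b" using q by (simp add: pos_le_divide_eq mult.commute)
        then have zj: "\<bar>z $ j - a $ j\<bar> \<le> s / b" for j
          using component_le_norm_cart[of "z - a" j] by simp
        have "a' $ j \<le> z $ j" "z $ j \<le> a' $ j + \<sigma>" for j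
          using zj[of j] by (auto simp: a'_def \<sigma>_def abs_le_iff)
        then show "z \<in> ?Q" by (simp add: mem_box_cart)
        show "?dens z \<le> 2 * g" using e(3)[of z] zb th by auto
      qed
      have "emeasure \<mu> ?A \<le> (\<integral>\<^sup>+z\<in>?Q. ennreal (2 * g) \<partial>lborel)" unfolding vA
        by (intro nn_integral_mono) (use Q in \<open>auto simp: indicator_def intro!: ennreal_leI\<close>)
      also have "\<dots> = ennreal (2 * g) * emeasure lborel ?Q" by (simp add: nn_integral_cmult_indicator)
      also have "\<dots> = ennreal (C * s ^ ?k)"
      proof -
        have "C * s ^ ?k = 2 * g * \<sigma> ^ ?k" by (simp add: C_def \<sigma>_def power_divide power_mult_distrib)
        then show ?thesis using e(2) \<sigma> by (simp add: emeasure_lborel_cube ennreal_mult)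
      qed
      finally show "emeasure \<mu> ?A \<le> ennreal (C * s ^ ?k)" .
    qed
  qed (fact r)
qed

lemma half_space_midpoint: "a \<in> half_space i \<Longrightarrow> a' \<in> half_space i \<Longrightarrow> midpoint a a' \<in> half_space i"
  by (simp add: half_space_def midpoint_def)

text \<open>
  The image of the midpoint in coordinates serves as approximate midpoint; it exists since the chart
  domain is convex near \<open>z0\<close>, also at the boundary.
\<close>
lemma local_approximate_midpoints:
  fixes M :: "(real^'d::finite) set"
  assumes chart: "local_parametrization M (i::'k::finite) U \<phi>" and z0: "z0 \<in> U \<inter> half_space i"
  obtains r where "0 < r"
    "\<And>x y. x \<in> M \<inter> ball (\<phi> z0) r \<Longrightarrow> y \<in> M \<inter> ball (\<phi> z0) r \<Longrightarrow>
       \<exists>m\<in>M. dist x m \<le> 3/5 * dist x y \<and> dist y m \<le> 3/5 * dist x y"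
proof -
  let ?D = "U \<inter> half_space i"
  obtain \<delta> where q: "0 < \<delta>" "ball z0 \<delta> \<subseteq> U"
    "\<And>a a'. a \<in> ball z0 \<delta> \<Longrightarrow> a' \<in> ball z0 \<delta> \<Longrightarrow>
       norm (\<phi> (midpoint a a') - \<phi> a) \<le> 3/5 * norm (\<phi> a' - \<phi> a)"
    by (rule chart_quasi_isometry[OF chart z0]) blast
  obtain \<rho> where \<rho>: "0 < \<rho>" "M \<inter> ball (\<phi> z0) \<rho> \<subseteq> \<phi> ` (?D \<inter> ball z0 \<delta>)"
    using chart_image_contains_ball[OF chart z0 q(1)] by blast
  show thesis
  proof (rule that[OF \<rho>(1)])
    fix x y assume "x \<in> M \<inter> ball (\<phi> z0) \<rho>" "y \<in> M \<inter> ball (\<phi> z0) \<rho>"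
    then obtain a a' where a: "x = \<phi> a" "y = \<phi> a'" "a \<in> ?D" "a' \<in> ?D" "a \<in> ball z0 \<delta>" "a' \<in> ball z0 \<delta>"
      using \<rho>(2) by blast
    have "midpoint a a' \<in> ball z0 \<delta>"
      using convexD[OF convex_ball, of a z0 \<delta> a' "1/2" "1/2"] a
      by (simp add: midpoint_def scaleR_add_right)
    then have "midpoint a a' \<in> ?D" using q(2) half_space_midpoint a by blast
    then have "\<phi> (midpoint a a') \<in> M" by (rule chart_maps_into[OF chart])
    moreover have "dist x (\<phi> (midpoint a a')) \<le> 3/5 * dist x y"
      using q(3)[of a a'] a by (simp add: dist_norm norm_minus_commute)
    moreover have "dist y (\<phi> (midpoint a a')) \<le> 3/5 * dist x y"
      using q(3)[of a' a] a by (simp add: dist_norm norm_minus_commute midpoint_sym)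
    ultimately show "\<exists>m\<in>M. dist x m \<le> 3/5 * dist x y \<and> dist y m \<le> 3/5 * dist x y" by blast
  qed
qed

text \<open>
  Compactness makes the local constants uniform.  The covering uses balls of half the local radii, so
  that pairs of close points lie in a common neighbourhood.
\<close>
lemma volume_regularity_and_midpoints:
  fixes M :: "(real^'d::finite) set"
  assumes comp: "compact M" and sm: "smooth_submanifold_with_boundary TYPE('k::finite) M"
    and vol: "volume_measure_on TYPE('k) M \<mu>"
  obtains r c C where "0 < r" "0 < c" "0 < C"
    "\<And>x s. x \<in> M \<Longrightarrow> 0 \<le> s \<Longrightarrow> s < r \<Longrightarrow>
       ennreal (c * s ^ CARD('k)) \<le> emeasure \<mu> (M \<inter> cball x s) \<and>
       emeasure \<mu> (M \<inter> cball x s) \<le> ennreal (C * s ^ CARD('k))"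
    "\<And>x y. x \<in> M \<Longrightarrow> y \<in> M \<Longrightarrow> dist x y < r \<Longrightarrow>
       \<exists>m\<in>M. dist x m \<le> 3/5 * dist x y \<and> dist y m \<le> 3/5 * dist x y"
proof -
  define P where "P w r c C \<longleftrightarrow> 0 < r \<and> 0 < c \<and> 0 < C \<and>
    (\<forall>x\<in>M \<inter> ball w r. \<forall>s. 0 \<le> s \<longrightarrow> s < r \<longrightarrow>
       ennreal (c * s ^ CARD('k)) \<le> emeasure \<mu> (M \<inter> cball x s) \<and>
       emeasure \<mu> (M \<inter> cball x s) \<le> ennreal (C * s ^ CARD('k))) \<and>
    (\<forall>x\<in>M \<inter> ball w r. \<forall>y\<in>M \<inter> ball w r.
       \<exists>m\<in>M. dist x m \<le> 3/5 * dist x y \<and> dist y m \<le> 3/5 * dist x y)" for w r c C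
  have "\<exists>r c C. P w r c C" if w: "w \<in> M" for w
  proof -
    obtain i :: 'k and U \<phi> z0 where ch: "local_parametrization M i U \<phi>" "z0 \<in> U \<inter> half_space i" "w = \<phi> z0"
      using sm w unfolding smooth_submanifold_with_boundary_def by blast
    obtain r1 c C where 1: "0 < r1" "0 < c" "0 < C"
      "\<And>x s. x \<in> M \<inter> ball (\<phi> z0) r1 \<Longrightarrow> 0 \<le> s \<Longrightarrow> s < r1 \<Longrightarrow>
       ennreal (c * s ^ CARD('k)) \<le> emeasure \<mu> (M \<inter> cball x s) \<and>
       emeasure \<mu> (M \<inter> cball x s) \<le> ennreal (C * s ^ CARD('k))"
      using local_ball_volume_bounds[OF vol ch(1,2)] by blast
    obtain r2 where 2: "0 < r2"
      "\<And>x y. x \<in> M \<inter> ball (\<phi> z0) r2 \<Longrightarrow> y \<in> M \<inter> ball (\<phi> z0) r2 \<Longrightarrow>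
       \<exists>m\<in>M. dist x m \<le> 3/5 * dist x y \<and> dist y m \<le> 3/5 * dist x y"
      using local_approximate_midpoints[OF ch(1,2)] by blast
    have "P w (min r1 r2) c C"
      unfolding P_def
    proof (intro conjI ballI allI impI)
      fix x y assume "x \<in> M \<inter> ball w (min r1 r2)" "y \<in> M \<inter> ball w (min r1 r2)"
      then show "\<exists>m\<in>M. dist x m \<le> 3/5 * dist x y \<and> dist y m \<le> 3/5 * dist x y"
        using 2(2)[of x y] ch(3) by simp
    qed (use 1 2(1) ch(3) in simp_all)
    then show ?thesis by blast
  qed
  then obtain rr cc CC where P': "\<And>w. w \<in> M \<Longrightarrow> P w (rr w) (cc w) (CC w)" by metis
  note P = P'[unfolded P_def]
  have "M \<subseteq> (\<Union>w\<in>M. ball w (rr w / 2))"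
  proof
    fix w assume "w \<in> M"
    moreover from this have "w \<in> ball w (rr w / 2)" using P by simp
    ultimately show "w \<in> (\<Union>w\<in>M. ball w (rr w / 2))" by blast
  qed
  then obtain F where F: "F \<subseteq> M" "finite F" "M \<subseteq> (\<Union>w\<in>F. ball w (rr w / 2))"
    using compactE_image[OF comp, of M "\<lambda>w. ball w (rr w / 2)"] by blast
  define r where "r = Min (insert 1 ((\<lambda>w. rr w / 2) ` F))"
  define c where "c = Min (insert 1 (cc ` F))"
  define C where "C = Max (insert 1 (CC ` F))"
  have pos: "0 < rr w" "0 < cc w" "0 < CC w" if "w \<in> F" for w using P that F by blast+
  have le: "r \<le> rr w / 2" "c \<le> cc w" "CC w \<le> C" if "w \<in> F" for w
    unfolding r_def c_def C_def by (rule Min_le Max_ge; use that F(2) in simp)+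
  show thesis
  proof (rule that[of r c C])
    show "0 < r" "0 < c" using pos F(2) by (auto simp: r_def c_def)
    show "0 < C" unfolding C_def using F(2) by (simp add: Max_gr_iff)
  next
    fix x s assume x: "x \<in> M" and s: "0 \<le> (s::real)" "s < r"
    obtain w where w: "w \<in> F" "x \<in> ball w (rr w / 2)" using x F by blast
    then have "x \<in> M \<inter> ball w (rr w)" "s < rr w" using x le[OF w(1)] s pos[OF w(1)] by auto
    then have *: "ennreal (cc w * s ^ CARD('k)) \<le> emeasure \<mu> (M \<inter> cball x s)"
       "emeasure \<mu> (M \<inter> cball x s) \<le> ennreal (CC w * s ^ CARD('k))"
      using P[of w] w(1) F(1) s by blast+
    have "ennreal (c * s ^ CARD('k)) \<le> ennreal (cc w * s ^ CARD('k))"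
         "ennreal (CC w * s ^ CARD('k)) \<le> ennreal (C * s ^ CARD('k))"
      using le[OF w(1)] s by (auto intro!: ennreal_leI mult_right_mono)
    with * show "ennreal (c * s ^ CARD('k)) \<le> emeasure \<mu> (M \<inter> cball x s) \<and>
       emeasure \<mu> (M \<inter> cball x s) \<le> ennreal (C * s ^ CARD('k))" by (meson order_trans)
  next
    fix x y assume xy: "x \<in> M" "y \<in> M" "dist x y < r"
    obtain w where w: "w \<in> F" "x \<in> ball w (rr w / 2)" using xy F by blast
    have "dist w y < rr w" using w(2) xy(3) le(1)[OF w(1)] dist_triangle[of w y x] by simp
    then have "x \<in> M \<inter> ball w (rr w)" "y \<in> M \<inter> ball w (rr w)" using w(2) xy pos[OF w(1)] by auto
    then show "\<exists>m\<in>M. dist x m \<le> 3/5 * dist x y \<and> dist y m \<le> 3/5 * dist x y"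
      using P[of w] w(1) F(1) by blast
  qed
qed

lemma finite_volume:
  fixes M :: "(real^'d::finite) set"
  assumes comp: "compact M" and sm: "smooth_submanifold_with_boundary TYPE('k::finite) M"
    and vol: "volume_measure_on TYPE('k) M \<mu>"
  shows "finite_measure \<mu>"
proof
  obtain r c C where reg: "0 < r" "0 < c" "0 < C"
    "\<And>x s. x \<in> M \<Longrightarrow> 0 \<le> s \<Longrightarrow> s < r \<Longrightarrow>
       ennreal (c * s ^ CARD('k)) \<le> emeasure \<mu> (M \<inter> cball x s) \<and>
       emeasure \<mu> (M \<inter> cball x s) \<le> ennreal (C * s ^ CARD('k))"
    using volume_regularity_and_midpoints[OF assms] by metis
  have "M \<subseteq> (\<Union>w\<in>M. ball w (r / 2))" using reg(1) by force
  then obtain F where F: "F \<subseteq> M" "finite F" "M \<subseteq> (\<Union>w\<in>F. ball w (r / 2))"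
    using compactE_image[OF comp, of M "\<lambda>w. ball w (r / 2)"] by blast
  have "emeasure \<mu> (space \<mu>) \<le> emeasure \<mu> (\<Union>w\<in>F. M \<inter> cball w (r / 2))"
    unfolding space_volume_measure[OF vol]
  proof (rule emeasure_mono)
    show "M \<subseteq> (\<Union>w\<in>F. M \<inter> cball w (r / 2))"
    proof
      fix x assume "x \<in> M"
      moreover from this obtain w where "w \<in> F" "x \<in> ball w (r / 2)" using F(3) by blast
      ultimately show "x \<in> (\<Union>w\<in>F. M \<inter> cball w (r / 2))" using ball_subset_cball by blast
    qed
    show "(\<Union>w\<in>F. M \<inter> cball w (r / 2)) \<in> sets \<mu>"
      using F(2) cball_in_sets_volume_measure[OF vol] by (intro sets.finite_UN) auto
  qed
  also have "\<dots> \<le> (\<Sum>w\<in>F. emeasure \<mu> (M \<inter> cball w (r / 2)))"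
    by (rule emeasure_subadditive_finite) (use F cball_in_sets_volume_measure[OF vol] in auto)
  also have "\<dots> < \<infinity>"
  proof -
    have "emeasure \<mu> (M \<inter> cball w (r / 2)) < \<infinity>" if "w \<in> F" for w
    proof -
      have "emeasure \<mu> (M \<inter> cball w (r / 2)) \<le> ennreal (C * (r / 2) ^ CARD('k))"
        using reg(4)[of w "r/2"] that F(1) reg(1) by auto
      also have "\<dots> < \<infinity>" by simp
      finally show ?thesis .
    qed
    then show ?thesis by (simp add: F(2))
  qed
  finally show "emeasure \<mu> (space \<mu>) \<noteq> \<infinity>" by simp
qed

section \<open>Tangent spaces and gradients\<close>

lemma chart_range_subspace:
  assumes "local_parametrization M i U \<phi>" "z0 \<in> U \<inter> half_space i"
  shows "subspace (range (frechet_derivative \<phi> (at z0)))"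
proof -
  have "smooth_on U \<phi>" "z0 \<in> U" using assms unfolding local_parametrization_def by auto
  then have "linear (frechet_derivative \<phi> (at z0))"
    using smooth_on_imp_differentiable has_derivative_linear by blast
  then show ?thesis by (simp add: linear_subspace_image)
qed

text \<open>
  Together with the next lemma this describes the tangent space without charts: \<open>n\<close> is normal to it
  exactly if \<open>n \<bullet> h\<close> is a derivative of the zero function within \<open>M\<close>.  Here, points of \<open>M\<close>
  near \<open>x\<close> differ from \<open>x\<close> by a tangent vector up to an error of smaller order.
\<close>
lemma normal_to_chart_has_zero_derivative:
  fixes \<phi> :: "real^'k::finite \<Rightarrow> real^'d::finite"
  assumes chart: "local_parametrization M i U \<phi>" and z0: "z0 \<in> U \<inter> half_space i"
    and n: "\<And>w. n \<bullet> frechet_derivative \<phi> (at z0) w = 0"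
  shows "((\<lambda>_. 0::real) has_derivative (\<lambda>h. n \<bullet> h)) (at (\<phi> z0) within M)"
  unfolding has_derivative_within_alt
proof (intro conjI allI impI)
  show "bounded_linear (\<lambda>h. n \<bullet> h)" by (rule bounded_linear_inner_right)
  fix e :: real assume e: "0 < e"
  obtain \<delta> b L where q: "0 < \<delta>" "0 < b"
    "\<And>a a'. a \<in> ball z0 \<delta> \<Longrightarrow> a' \<in> ball z0 \<delta> \<Longrightarrow> b * norm (a' - a) \<le> norm (\<phi> a' - \<phi> a)"
    by (rule chart_quasi_isometry[OF chart z0]) blast
  have sm: "open U" "smooth_on U \<phi>" "z0 \<in> U"
    using chart z0 unfolding local_parametrization_def by auto
  define \<epsilon> where "\<epsilon> = e * b / (norm n + 1)"
  have n1: "0 < norm n + 1" by (simp add: add_nonneg_pos)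
  have "0 < \<epsilon>" using e q n1 by (simp add: \<epsilon>_def)
  then obtain \<delta>' where d: "0 < \<delta>'"
    "\<And>a a'. a \<in> ball z0 \<delta>' \<Longrightarrow> a' \<in> ball z0 \<delta>' \<Longrightarrow>
       norm (\<phi> a' - \<phi> a - frechet_derivative \<phi> (at z0) (a' - a)) \<le> \<epsilon> * norm (a' - a)"
    using smooth_on_almost_linear[OF sm] by metis
  define \<eta> where "\<eta> = min \<delta> \<delta>'"
  have "0 < \<eta>" using q d by (simp add: \<eta>_def)
  then obtain \<rho> where \<rho>: "0 < \<rho>" "M \<inter> ball (\<phi> z0) \<rho> \<subseteq> \<phi> ` (U \<inter> half_space i \<inter> ball z0 \<eta>)"
    using chart_image_contains_ball[OF chart z0] by blast
  show "\<exists>d>0. \<forall>y\<in>M. norm (y - \<phi> z0) < d \<longrightarrow> norm (0 - 0 - n \<bullet> (y - \<phi> z0)) \<le> e * norm (y - \<phi> z0)"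
  proof (intro exI[of _ \<rho>] conjI ballI impI)
    fix y assume y: "y \<in> M" "norm (y - \<phi> z0) < \<rho>"
    have "y \<in> M \<inter> ball (\<phi> z0) \<rho>" using y by (simp add: dist_norm norm_minus_commute)
    then obtain z where z: "y = \<phi> z" "z \<in> ball z0 \<eta>" using \<rho>(2) by blast
    then have zz: "z \<in> ball z0 \<delta>" "z \<in> ball z0 \<delta>'" "z0 \<in> ball z0 \<delta>" "z0 \<in> ball z0 \<delta>'"
      using q d by (auto simp: \<eta>_def)
    let ?E = "y - \<phi> z0 - frechet_derivative \<phi> (at z0) (z - z0)"
    have "n \<bullet> (y - \<phi> z0) = n \<bullet> ?E" by (simp add: inner_diff_right n)
    then have "norm (n \<bullet> (y - \<phi> z0)) \<le> norm n * norm ?E" using Cauchy_Schwarz_ineq2 by simp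
    also have "\<dots> \<le> (norm n + 1) * (\<epsilon> * norm (z - z0))"
      using d(2)[OF zz(4,2)] z by (intro mult_mono) auto
    also have "\<dots> = e * (b * norm (z - z0))" using n1 by (simp add: \<epsilon>_def)
    also have "\<dots> \<le> e * norm (y - \<phi> z0)" using q(3)[OF zz(3,1)] e z(1) by simp
    finally show "norm (0 - 0 - n \<bullet> (y - \<phi> z0)) \<le> e * norm (y - \<phi> z0)" by simp
  qed (fact \<rho>(1))
qed

text \<open>
  Vectors \<open>w\<close> that point into the half-space give curves in \<open>M\<close> with velocity \<open>A w\<close>, where \<open>A\<close> is
  the derivative of the chart; at a boundary point these curves are defined for nonnegative times
  only.  Since either \<open>w\<close> or \<open>- w\<close> points into the half-space, linearity covers the rest.
\<close>
lemma zero_derivative_normal_to_chart: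
  fixes \<phi> :: "real^'k::finite \<Rightarrow> real^'d::finite"
  assumes chart: "local_parametrization M i U \<phi>" and z0: "z0 \<in> U \<inter> half_space i"
    and der: "((\<lambda>_. 0::real) has_derivative (\<lambda>h. n \<bullet> h)) (at (\<phi> z0) within M)"
  shows "n \<bullet> frechet_derivative \<phi> (at z0) w = 0"
proof -
  let ?A = "frechet_derivative \<phi> (at z0)"
  have sm: "open U" "smooth_on U \<phi>" "z0 \<in> U"
    using chart z0 unfolding local_parametrization_def by auto
  have d\<phi>: "(\<phi> has_derivative ?A) (at z0)" by (rule smooth_on_imp_differentiable[OF sm(2,3)])
  then have lin: "linear ?A" by (rule has_derivative_linear)
  have zero: "n \<bullet> ?A w = 0" if w: "0 \<le> w $ i" for w
  proof -
    obtain \<eta> where \<eta>: "0 < \<eta>" "ball z0 \<eta> \<subseteq> U" using sm openE by blast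
    define \<tau> where "\<tau> = \<eta> / (norm w + 1)"
    have w1: "0 < norm w + 1" by (simp add: add_nonneg_pos)
    have \<tau>: "0 < \<tau>" using \<eta> w1 by (simp add: \<tau>_def)
    let ?S = "{0..<\<tau>}"
    have inD: "z0 + s *\<^sub>R w \<in> U \<inter> half_space i" if s: "s \<in> ?S" for s
    proof
      have "norm (s *\<^sub>R w) \<le> s * (norm w + 1)" using s by (auto intro!: mult_left_mono)
      also have "\<dots> < \<tau> * (norm w + 1)" using s w1 by (intro mult_strict_right_mono) auto
      also have "\<dots> = \<eta>" using w1 by (simp add: \<tau>_def)
      finally have "z0 + s *\<^sub>R w \<in> ball z0 \<eta>" by (simp add: dist_norm)
      then show "z0 + s *\<^sub>R w \<in> U" using \<eta> by blast
      show "z0 + s *\<^sub>R w \<in> half_space i" using z0 w s by (simp add: half_space_def)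
    qed
    let ?\<gamma> = "\<lambda>s. \<phi> (z0 + s *\<^sub>R w)"
    have d1: "(?\<gamma> has_derivative (\<lambda>s. ?A (s *\<^sub>R w))) (at 0 within ?S)"
    proof (rule has_derivative_compose[of "\<lambda>s. z0 + s *\<^sub>R w"])
      show "((\<lambda>s. z0 + s *\<^sub>R w) has_derivative (\<lambda>s. s *\<^sub>R w)) (at 0 within ?S)"
        by (auto intro!: derivative_eq_intros)
      show "(\<phi> has_derivative ?A) (at (z0 + 0 *\<^sub>R w))" using d\<phi> by simp
    qed
    have "((\<lambda>_. 0::real) has_derivative (\<lambda>h. n \<bullet> h)) (at (?\<gamma> 0) within ?\<gamma> ` ?S)"
      using der inD chart_maps_into[OF chart] by (auto intro: has_derivative_subset)
    from diff_chain_within[OF d1 this]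
    have d2: "((\<lambda>_. 0::real) has_derivative (\<lambda>s. n \<bullet> ?A (s *\<^sub>R w))) (at 0 within ?S)"
      by (simp add: o_def)
    then have "((\<lambda>_. 0::real) has_derivative (\<lambda>s. s * (n \<bullet> ?A w))) (at 0 within ?S)"
      by (simp add: linear_scale[OF lin])
    then have v1: "((\<lambda>_. 0::real) has_real_derivative (n \<bullet> ?A w)) (at 0 within ?S)"
      by (simp add: has_field_derivative_def mult.commute[of _ "n \<bullet> ?A w"] mult_commute_abs)
    have v2: "((\<lambda>_. 0::real) has_real_derivative 0) (at 0 within ?S)" by simp
    have "at 0 within ?S \<noteq> bot"
      using \<tau> by (simp add: trivial_limit_within islimpt_Ico) 
    with v1 v2 show ?thesis using has_field_derivative_unique by blast
  qed
  show ?thesis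
  proof (cases "0 \<le> w $ i")
    case False
    then have "n \<bullet> ?A (- w) = 0" by (intro zero) simp
    then show ?thesis by (simp add: linear_neg[OF lin])
  qed (rule zero)
qed

text \<open>
  The normals are characterized independently of the chart by the two preceding lemmas, so all charts
  at a point have the same tangent space.
\<close>
lemma tangent_space_eq_chart_range:
  fixes M :: "(real^'d::finite) set"
  assumes chart: "local_parametrization M (i::'k::finite) U \<phi>" and z0: "z0 \<in> U \<inter> half_space i"
  shows "tangent_space TYPE('k) M (\<phi> z0) = range (frechet_derivative \<phi> (at z0))"
proof
  show "range (frechet_derivative \<phi> (at z0)) \<subseteq> tangent_space TYPE('k) M (\<phi> z0)"
    using assms unfolding tangent_space_def by blast
  show "tangent_space TYPE('k) M (\<phi> z0) \<subseteq> range (frechet_derivative \<phi> (at z0))"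
  proof
    fix \<tau> assume "\<tau> \<in> tangent_space TYPE('k) M (\<phi> z0)"
    then obtain j :: 'k and V \<theta> z w where ch: "local_parametrization M j V \<theta>" "z \<in> V \<inter> half_space j"
      "\<theta> z = \<phi> z0" "\<tau> = frechet_derivative \<theta> (at z) w"
      unfolding tangent_space_def by blast
    let ?T = "range (frechet_derivative \<phi> (at z0))"
    obtain y n where yn: "y \<in> span ?T" "\<And>v. v \<in> span ?T \<Longrightarrow> orthogonal n v" "\<tau> = y + n"
      using orthogonal_subspace_decomp_exists[of ?T \<tau>] by metis
    have sp: "span ?T = ?T" using chart_range_subspace[OF assms] by (simp add: span_eq_iff)
    have "n \<bullet> frechet_derivative \<phi> (at z0) v = 0" for v
      using yn(2) sp by (auto simp: orthogonal_def)
    then have "((\<lambda>_. 0::real) has_derivative (\<lambda>h. n \<bullet> h)) (at (\<theta> z) within M)"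
      using normal_to_chart_has_zero_derivative[OF chart z0] ch(3) by simp
    then have "n \<bullet> \<tau> = 0" using zero_derivative_normal_to_chart[OF ch(1,2)] ch(4) by simp
    moreover have "n \<bullet> y = 0" using yn(1,2) by (auto simp: orthogonal_def)
    ultimately have "n \<bullet> n = 0" using yn(3) by (simp add: inner_add_right)
    then show "\<tau> \<in> ?T" using yn(1,3) sp by simp
  qed
qed

text \<open>
  The projection of \<open>G\<close> to the tangent space still represents the derivative within \<open>M\<close>, and it
  is the only tangent vector that does; so it is the gradient on \<open>M\<close>.
\<close>
lemma norm_manifold_gradient_le:
  fixes M :: "(real^'d::finite) set"
  assumes sm: "smooth_submanifold_with_boundary TYPE('k::finite) M" and x: "x \<in> M"
    and f: "(f has_derivative (\<lambda>h. G \<bullet> h)) (at x within M)"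
  shows "norm (manifold_gradient TYPE('k) M f x) \<le> norm G"
proof -
  obtain i :: 'k and U \<phi> z0 where ch: "local_parametrization M i U \<phi>" "z0 \<in> U \<inter> half_space i" "x = \<phi> z0"
    using sm x unfolding smooth_submanifold_with_boundary_def by blast
  let ?T = "tangent_space TYPE('k) M x"
  have T: "?T = range (frechet_derivative \<phi> (at z0))"
    using tangent_space_eq_chart_range[OF ch(1,2)] ch(3) by simp
  have sub: "subspace ?T" unfolding T by (rule chart_range_subspace[OF ch(1,2)])
  then have sp: "span ?T = ?T" by (simp add: span_eq_iff)
  obtain g n where gn: "g \<in> ?T" "\<And>v. v \<in> ?T \<Longrightarrow> orthogonal n v" "G = g + n"
    using orthogonal_subspace_decomp_exists[of ?T G] sp by metis
  have n0: "((\<lambda>_. 0::real) has_derivative (\<lambda>h. n \<bullet> h)) (at x within M)"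
    unfolding ch(3) by (rule normal_to_chart_has_zero_derivative[OF ch(1,2)])
      (use gn(2) T in \<open>auto simp: orthogonal_def\<close>)
  have fg: "(f has_derivative (\<lambda>h. g \<bullet> h)) (at x within M)"
    using has_derivative_diff[OF f n0] by (simp add: gn(3) inner_add_left)
  have "manifold_gradient TYPE('k) M f x = g"
    unfolding manifold_gradient_def
  proof (rule the_equality)
    fix g' assume g': "g' \<in> ?T \<and> (f has_derivative (\<lambda>h. g' \<bullet> h)) (at x within M)"
    then have "((\<lambda>_. 0::real) has_derivative (\<lambda>h. (g' - g) \<bullet> h)) (at x within M)"
      using has_derivative_diff[of f _ "at x within M" f] fg by (fastforce simp: inner_diff_left)
    then have "(g' - g) \<bullet> frechet_derivative \<phi> (at z0) w = 0" for w
      unfolding ch(3) by (rule zero_derivative_normal_to_chart[OF ch(1,2)])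
    moreover have "g' - g \<in> ?T" using g' gn(1) sub by (simp add: subspace_diff)
    then obtain w where "g' - g = frechet_derivative \<phi> (at z0) w" unfolding T by blast
    ultimately have "(g' - g) \<bullet> (g' - g) = 0" by metis
    then show "g' = g" by simp
  qed (use gn fg in auto)
  moreover have "norm g \<le> norm G"
  proof -
    have "g \<bullet> n = 0" using gn(1,2) by (simp add: orthogonal_def inner_commute)
    then have "(norm G)\<^sup>2 = (norm g)\<^sup>2 + (norm n)\<^sup>2"
      unfolding gn(3) by (simp add: norm_add_Pythagorean orthogonal_def)
    then show ?thesis by (smt (verit) norm_ge_zero power2_le_imp_le zero_le_power2)
  qed
  ultimately show ?thesis by simp
qed

section \<open>Comparing energies at two scales\<close>

lemma power2_diff_le_via_third:
  fixes a b c :: real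
  shows "(a - b)\<^sup>2 \<le> 2 * (a - c)\<^sup>2 + 2 * (c - b)\<^sup>2"
  using zero_le_power2[of "(a - c) - (c - b)"] by (simp add: power2_eq_square algebra_simps)

text \<open>
  The triple integrals are taken over triples \<open>(x, z, y)\<close> in which consecutive points are
  \<open>7/5 * s\<close>-close; integrating out the endpoint that does not occur in the integrand costs at most
  the factor \<open>b\<close>.  The two terms of the averaged inequality contribute equally by symmetry.
\<close>
lemma chaining_nn_integral:
  fixes \<mu> :: "'a::euclidean_space measure" and u :: "'a \<Rightarrow> real"
  assumes fin: "finite_measure \<mu>" and id_meas[measurable]: "(\<lambda>x. x) \<in> borel_measurable \<mu>"
    and u[measurable]: "u \<in> borel_measurable \<mu>"
    and low: "\<And>x. x \<in> space \<mu> \<Longrightarrow> ennreal a \<le> emeasure \<mu> (space \<mu> \<inter> cball x (s/5))"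
    and up: "\<And>x. x \<in> space \<mu> \<Longrightarrow> emeasure \<mu> (space \<mu> \<inter> cball x (7/5 * s)) \<le> ennreal b"
    and mid: "\<And>x y. x \<in> space \<mu> \<Longrightarrow> y \<in> space \<mu> \<Longrightarrow> dist x y \<le> 2 * s \<Longrightarrow>
       \<exists>m\<in>space \<mu>. dist x m \<le> 6/5 * s \<and> dist y m \<le> 6/5 * s"
  shows "ennreal a * (\<integral>\<^sup>+x. \<integral>\<^sup>+y. indicator {..2 * s} (dist x y) * ennreal ((u x - u y)\<^sup>2) \<partial>\<mu> \<partial>\<mu>)
    \<le> 4 * ennreal b * (\<integral>\<^sup>+x. \<integral>\<^sup>+y. indicator {..7/5 * s} (dist x y) * ennreal ((u x - u y)\<^sup>2) \<partial>\<mu> \<partial>\<mu>)"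
proof -
  interpret finite_measure \<mu> by (rule fin)
  interpret P: pair_sigma_finite \<mu> \<mu> ..
  define ind :: "real \<Rightarrow> 'a \<Rightarrow> 'a \<Rightarrow> ennreal" where "ind \<rho> x y = indicator {..\<rho>} (dist x y)" for \<rho> x y
  define q where "q x y = ennreal ((u x - u y)\<^sup>2)" for x y
  have ind_meas[measurable]: "case_prod (ind \<rho>) \<in> borel_measurable (\<mu> \<Otimes>\<^sub>M \<mu>)" for \<rho>
    unfolding ind_def by measurable
  have q_meas[measurable]: "case_prod q \<in> borel_measurable (\<mu> \<Otimes>\<^sub>M \<mu>)"
    unfolding q_def by measurable
  have ind_sym: "ind \<rho> x y = ind \<rho> y x" and q_sym: "q x y = q y x" for \<rho> x y
    by (auto simp: ind_def q_def dist_commute power2_commute)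
  let ?r = "7/5 * s"
  have cball_meas[measurable]: "space \<mu> \<inter> cball x \<rho> \<in> sets \<mu>" for x \<rho>
  proof -
    have "space \<mu> \<inter> cball x \<rho> = {y \<in> space \<mu>. dist x y \<le> \<rho>}" by auto
    then show ?thesis by simp
  qed
  \<comment> \<open>Every point \<open>z\<close> near an approximate midpoint of \<open>x\<close> and \<open>y\<close> is close to both.\<close>
  have pointwise: "ennreal a * (ind (2 * s) x y * q x y)
      \<le> (\<integral>\<^sup>+z. ind ?r x z * ind ?r z y * (2 * q x z + 2 * q z y) \<partial>\<mu>)"
    if x: "x \<in> space \<mu>" and y: "y \<in> space \<mu>" for x y
  proof (cases "dist x y \<le> 2 * s")
    case True
    obtain m where m: "m \<in> space \<mu>" "dist x m \<le> 6/5 * s" "dist y m \<le> 6/5 * s"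
      using mid[OF x y True] by blast
    have "ennreal a * (ind (2 * s) x y * q x y) = q x y * ennreal a"
      using True by (simp add: ind_def mult.commute)
    also have "\<dots> \<le> q x y * emeasure \<mu> (space \<mu> \<inter> cball m (s/5))"
      by (intro mult_left_mono low m) simp
    also have "\<dots> = (\<integral>\<^sup>+z. q x y * indicator (space \<mu> \<inter> cball m (s/5)) z \<partial>\<mu>)"
      by (simp add: nn_integral_cmult_indicator)
    also have "\<dots> \<le> (\<integral>\<^sup>+z. ind ?r x z * ind ?r z y * (2 * q x z + 2 * q z y) \<partial>\<mu>)"
    proof (rule nn_integral_mono)
      fix z
      show "q x y * indicator (space \<mu> \<inter> cball m (s/5)) z
          \<le> ind ?r x z * ind ?r z y * (2 * q x z + 2 * q z y)"
      proof (cases "z \<in> space \<mu> \<inter> cball m (s/5)")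
        case True
        then have "dist m z \<le> s/5" by simp
        then have "dist x z \<le> ?r" "dist z y \<le> ?r"
          using m dist_triangle[of x z m] dist_triangle[of y z m] by (auto simp: dist_commute)
        moreover have "q x y \<le> 2 * q x z + 2 * q z y"
        proof -
          have "q x y \<le> ennreal (2 * (u x - u z)\<^sup>2 + 2 * (u z - u y)\<^sup>2)"
            unfolding q_def by (rule ennreal_leI[OF power2_diff_le_via_third])
          also have "\<dots> = 2 * q x z + 2 * q z y" by (simp add: q_def ennreal_mult)
          finally show ?thesis .
        qed
        ultimately show ?thesis using True by (simp add: ind_def)
      qed simp
    qed
    finally show ?thesis .
  qed (simp add: ind_def)
  define T where "T = (\<integral>\<^sup>+x. \<integral>\<^sup>+y. \<integral>\<^sup>+z. ind ?r x z * ind ?r z y * q x z \<partial>\<mu> \<partial>\<mu> \<partial>\<mu>)"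
  have T_le: "T \<le> ennreal b * (\<integral>\<^sup>+x. \<integral>\<^sup>+z. ind ?r x z * q x z \<partial>\<mu> \<partial>\<mu>)"
  proof -
    have "T = (\<integral>\<^sup>+x. \<integral>\<^sup>+z. \<integral>\<^sup>+y. ind ?r x z * ind ?r z y * q x z \<partial>\<mu> \<partial>\<mu> \<partial>\<mu>)"
      unfolding T_def by (intro nn_integral_cong P.Fubini') measurable
    also have "\<dots> \<le> (\<integral>\<^sup>+x. \<integral>\<^sup>+z. ennreal b * (ind ?r x z * q x z) \<partial>\<mu> \<partial>\<mu>)"
    proof (intro nn_integral_mono)
      fix x z assume x: "x \<in> space \<mu>" and z: "z \<in> space \<mu>"
      have "(\<integral>\<^sup>+y. ind ?r x z * ind ?r z y * q x z \<partial>\<mu>)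
          = (\<integral>\<^sup>+y. (ind ?r x z * q x z) * indicator (space \<mu> \<inter> cball z ?r) y \<partial>\<mu>)"
        by (intro nn_integral_cong) (simp add: ind_def indicator_def)
      also have "\<dots> = (ind ?r x z * q x z) * emeasure \<mu> (space \<mu> \<inter> cball z ?r)"
        by (simp add: nn_integral_cmult_indicator)
      also have "\<dots> \<le> (ind ?r x z * q x z) * ennreal b" by (intro mult_left_mono up z) simp
      finally show "(\<integral>\<^sup>+y. ind ?r x z * ind ?r z y * q x z \<partial>\<mu>) \<le> ennreal b * (ind ?r x z * q x z)"
        by (simp add: mult.commute)
    qed
    also have "\<dots> = (\<integral>\<^sup>+x. ennreal b * (\<integral>\<^sup>+z. ind ?r x z * q x z \<partial>\<mu>) \<partial>\<mu>)"
      by (intro nn_integral_cong nn_integral_cmult) measurable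
    also have "\<dots> = ennreal b * (\<integral>\<^sup>+x. \<integral>\<^sup>+z. ind ?r x z * q x z \<partial>\<mu> \<partial>\<mu>)"
      by (intro nn_integral_cmult) measurable
    finally show ?thesis .
  qed
  have T_eq: "(\<integral>\<^sup>+x. \<integral>\<^sup>+y. \<integral>\<^sup>+z. ind ?r x z * ind ?r z y * q z y \<partial>\<mu> \<partial>\<mu> \<partial>\<mu>) = T"
  proof -
    have "(\<integral>\<^sup>+x. \<integral>\<^sup>+y. \<integral>\<^sup>+z. ind ?r x z * ind ?r z y * q z y \<partial>\<mu> \<partial>\<mu> \<partial>\<mu>)
        = (\<integral>\<^sup>+y. \<integral>\<^sup>+x. \<integral>\<^sup>+z. ind ?r x z * ind ?r z y * q z y \<partial>\<mu> \<partial>\<mu> \<partial>\<mu>)"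
      by (intro P.Fubini') measurable
    also have "\<dots> = T"
      unfolding T_def
      by (intro nn_integral_cong) (simp add: ind_sym q_sym mult_ac)
    finally show ?thesis .
  qed
  have "ennreal a * (\<integral>\<^sup>+x. \<integral>\<^sup>+y. ind (2 * s) x y * q x y \<partial>\<mu> \<partial>\<mu>)
      = (\<integral>\<^sup>+x. ennreal a * (\<integral>\<^sup>+y. ind (2 * s) x y * q x y \<partial>\<mu>) \<partial>\<mu>)"
    by (intro nn_integral_cmult[symmetric]) measurable
  also have "\<dots> = (\<integral>\<^sup>+x. \<integral>\<^sup>+y. ennreal a * (ind (2 * s) x y * q x y) \<partial>\<mu> \<partial>\<mu>)"
    by (intro nn_integral_cong nn_integral_cmult[symmetric]) measurable
  also have "\<dots> \<le> (\<integral>\<^sup>+x. \<integral>\<^sup>+y. \<integral>\<^sup>+z. ind ?r x z * ind ?r z y * (2 * q x z + 2 * q z y) \<partial>\<mu> \<partial>\<mu> \<partial>\<mu>)"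
    by (intro nn_integral_mono pointwise)
  also have "\<dots> = (\<integral>\<^sup>+x. \<integral>\<^sup>+y. \<integral>\<^sup>+z. 2 * (ind ?r x z * ind ?r z y * q x z)
      + 2 * (ind ?r x z * ind ?r z y * q z y) \<partial>\<mu> \<partial>\<mu> \<partial>\<mu>)"
    by (intro nn_integral_cong) (simp add: distrib_left mult_ac)
  also have "\<dots> = (\<integral>\<^sup>+x. \<integral>\<^sup>+y. 2 * (\<integral>\<^sup>+z. ind ?r x z * ind ?r z y * q x z \<partial>\<mu>)
      + 2 * (\<integral>\<^sup>+z. ind ?r x z * ind ?r z y * q z y \<partial>\<mu>) \<partial>\<mu> \<partial>\<mu>)"
    by (intro nn_integral_cong) (simp add: nn_integral_add nn_integral_cmult)
  also have "\<dots> = (\<integral>\<^sup>+x. 2 * (\<integral>\<^sup>+y. \<integral>\<^sup>+z. ind ?r x z * ind ?r z y * q x z \<partial>\<mu> \<partial>\<mu>)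
      + 2 * (\<integral>\<^sup>+y. \<integral>\<^sup>+z. ind ?r x z * ind ?r z y * q z y \<partial>\<mu> \<partial>\<mu>) \<partial>\<mu>)"
    by (intro nn_integral_cong) (simp add: nn_integral_add nn_integral_cmult)
  also have "\<dots> = 2 * T + 2 * (\<integral>\<^sup>+x. \<integral>\<^sup>+y. \<integral>\<^sup>+z. ind ?r x z * ind ?r z y * q z y \<partial>\<mu> \<partial>\<mu> \<partial>\<mu>)"
    unfolding T_def by (simp add: nn_integral_add nn_integral_cmult)
  also have "\<dots> = 4 * T" unfolding T_eq by (simp flip: distrib_right)
  also have "\<dots> \<le> 4 * (ennreal b * (\<integral>\<^sup>+x. \<integral>\<^sup>+z. ind ?r x z * q x z \<partial>\<mu> \<partial>\<mu>))"
    by (intro mult_left_mono T_le) simp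
  finally show ?thesis unfolding ind_def q_def by (simp add: mult.assoc)
qed

lemma integrable_difference_square:
  fixes u :: "'a \<Rightarrow> real"
  assumes fin: "finite_measure \<mu>" and u[measurable]: "u \<in> borel_measurable \<mu>"
    and u2: "integrable \<mu> (\<lambda>x. (u x)\<^sup>2)"
  shows "integrable (\<mu> \<Otimes>\<^sub>M \<mu>) (\<lambda>(x, y). (u x - u y)\<^sup>2)"
proof -
  interpret finite_measure \<mu> by (rule fin)
  interpret P: pair_sigma_finite \<mu> \<mu> ..
  have i: "integrable \<mu> u"
    by (rule square_integrable_imp_integrable[OF u u2])
  have *: "(u x - u y)\<^sup>2 = (u x)\<^sup>2 + (u y)\<^sup>2 - 2 * u x * u y" for x y by (simp add: power2_diff)
  have eq: "(\<integral>y. norm (case (x, y) of (x, y) \<Rightarrow> (u x - u y)\<^sup>2) \<partial>\<mu>)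
      = measure \<mu> (space \<mu>) * (u x)\<^sup>2 + (\<integral>y. (u y)\<^sup>2 \<partial>\<mu>) - 2 * u x * (\<integral>y. u y \<partial>\<mu>)" for x
  proof -
    have "(\<integral>y. norm (case (x, y) of (x, y) \<Rightarrow> (u x - u y)\<^sup>2) \<partial>\<mu>) = (\<integral>y. (u x - u y)\<^sup>2 \<partial>\<mu>)" by simp
    then show ?thesis using i u2 by (simp add: *)
  qed
  show ?thesis
  proof (rule P.Fubini_integrable)
    show "integrable \<mu> (\<lambda>x. \<integral>y. norm (case (x, y) of (x, y) \<Rightarrow> (u x - u y)\<^sup>2) \<partial>\<mu>)"
      unfolding eq using i u2 by simp
  qed (use i u2 in \<open>auto simp: *\<close>)
qed

lemma chaining:
  fixes \<mu> :: "'a::euclidean_space measure" and u :: "'a \<Rightarrow> real"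
  assumes fin: "finite_measure \<mu>" and id_meas[measurable]: "(\<lambda>x. x) \<in> borel_measurable \<mu>"
    and u[measurable]: "u \<in> borel_measurable \<mu>" and u2: "integrable \<mu> (\<lambda>x. (u x)\<^sup>2)"
    and ab: "0 \<le> a" "0 \<le> b"
    and low: "\<And>x. x \<in> space \<mu> \<Longrightarrow> ennreal a \<le> emeasure \<mu> (space \<mu> \<inter> cball x (s/5))"
    and up: "\<And>x. x \<in> space \<mu> \<Longrightarrow> emeasure \<mu> (space \<mu> \<inter> cball x (7/5 * s)) \<le> ennreal b"
    and mid: "\<And>x y. x \<in> space \<mu> \<Longrightarrow> y \<in> space \<mu> \<Longrightarrow> dist x y \<le> 2 * s \<Longrightarrow>
       \<exists>m\<in>space \<mu>. dist x m \<le> 6/5 * s \<and> dist y m \<le> 6/5 * s"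
  shows "a * (\<integral>(x, y). indicator {..2 * s} (dist x y) * (u x - u y)\<^sup>2 \<partial>(\<mu> \<Otimes>\<^sub>M \<mu>))
    \<le> 4 * b * (\<integral>(x, y). indicator {..7/5 * s} (dist x y) * (u x - u y)\<^sup>2 \<partial>(\<mu> \<Otimes>\<^sub>M \<mu>))"
proof -
  interpret finite_measure \<mu> by (rule fin)
  interpret P: pair_sigma_finite \<mu> \<mu> ..
  let ?f = "\<lambda>\<rho> (x, y). indicator {..\<rho>} (dist x y) * (u x - u y)\<^sup>2 :: real"
  have int: "integrable (\<mu> \<Otimes>\<^sub>M \<mu>) (?f \<rho>)" for \<rho>
    by (rule Bochner_Integration.integrable_bound[OF integrable_difference_square[OF fin u u2]])
      (auto simp: indicator_def)
  have conv: "(\<integral>\<^sup>+x. \<integral>\<^sup>+y. indicator {..\<rho>} (dist x y) * ennreal ((u x - u y)\<^sup>2) \<partial>\<mu> \<partial>\<mu>)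
      = ennreal (\<integral>z. ?f \<rho> z \<partial>(\<mu> \<Otimes>\<^sub>M \<mu>))" for \<rho>
  proof -
    have "(\<integral>\<^sup>+x. \<integral>\<^sup>+y. indicator {..\<rho>} (dist x y) * ennreal ((u x - u y)\<^sup>2) \<partial>\<mu> \<partial>\<mu>)
        = (\<integral>\<^sup>+x. \<integral>\<^sup>+y. (\<lambda>z. ennreal (?f \<rho> z)) (x, y) \<partial>\<mu> \<partial>\<mu>)"
      by (intro nn_integral_cong) (simp add: indicator_def)
    also have "\<dots> = (\<integral>\<^sup>+z. ennreal (?f \<rho> z) \<partial>(\<mu> \<Otimes>\<^sub>M \<mu>))"
      by (rule nn_integral_fst) measurable
    also have "\<dots> = ennreal (\<integral>z. ?f \<rho> z \<partial>(\<mu> \<Otimes>\<^sub>M \<mu>))"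
      by (rule nn_integral_eq_integral[OF int]) (auto simp: indicator_def)
    finally show ?thesis .
  qed
  have nn: "0 \<le> (\<integral>z. ?f \<rho> z \<partial>(\<mu> \<Otimes>\<^sub>M \<mu>))" for \<rho>
    by (rule Bochner_Integration.integral_nonneg) (auto simp: indicator_def)
  have "ennreal (a * (\<integral>z. ?f (2 * s) z \<partial>(\<mu> \<Otimes>\<^sub>M \<mu>)))
      \<le> ennreal (4 * b * (\<integral>z. ?f (7/5 * s) z \<partial>(\<mu> \<Otimes>\<^sub>M \<mu>)))"
    using chaining_nn_integral[OF fin id_meas u low up mid] nn ab unfolding conv
    by (simp add: ennreal_mult)
  then show ?thesis using nn ab by (subst (asm) ennreal_le_iff) auto
qed

section \<open>Gradient of the smoothed function\<close>

lemma derivative_zero_outside_support: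
  fixes f :: "real \<Rightarrow> real"
  assumes "(f has_real_derivative D) (at r within {0..})" "1 < r" "\<And>r. 1 < r \<Longrightarrow> f r = 0"
  shows "D = 0"
proof -
  have "r \<in> interior {0..}" using assms(2) by (intro interiorI[of "{0<..}"]) auto
  then have "(f has_real_derivative D) (at r)" using assms(1) at_within_interior by metis
  then have "((\<lambda>_. 0) has_real_derivative D) (at r)"
    by (rule has_field_derivative_transform_within_open[where S="{1<..}"]) (use assms in auto)
  then show ?thesis using DERIV_unique[OF DERIV_const] by blast
qed

lemma bounded_of_compact_support:
  fixes f :: "real \<Rightarrow> real"
  assumes "continuous_on {0..} f" "\<And>r. 1 < r \<Longrightarrow> f r = 0"
  obtains B where "\<And>r. 0 \<le> r \<Longrightarrow> \<bar>f r\<bar> \<le> B"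
proof -
  have "compact (f ` {0..1})"
    using assms(1) by (intro compact_continuous_image) (auto intro: continuous_on_subset)
  then obtain B where B: "\<And>r. r \<in> {0..1} \<Longrightarrow> \<bar>f r\<bar> \<le> B"
    using compact_imp_bounded bounded_iff by (metis image_eqI real_norm_def)
  have "\<bar>f r\<bar> \<le> \<bar>B\<bar>" if "0 \<le> r" for r
    using B[of r] assms(2)[of r] that by (cases "r \<le> 1") auto
  then show thesis by (rule that)
qed

text \<open>
  The second derivative is bounded since it is continuous and vanishes beyond \<open>1\<close>.  So the first
  derivative is Lipschitz, and the remainder of the first-order expansion is quadratic.
\<close>
lemma C2_compact_support_bounds:
  assumes "C2_on_nonneg R" and supp: "\<And>r. 1 < r \<Longrightarrow> R r = 0"
  obtains R' B where "1 \<le> B" "continuous_on {0..} R" "continuous_on {0..} R'"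
    "\<And>r. 1 < r \<Longrightarrow> R' r = 0"
    "\<And>r. 0 \<le> r \<Longrightarrow> \<bar>R r\<bar> \<le> B" "\<And>r. 0 \<le> r \<Longrightarrow> \<bar>R' r\<bar> \<le> B"
    "\<And>r r'. 0 \<le> r \<Longrightarrow> 0 \<le> r' \<Longrightarrow> \<bar>R r' - R r - R' r * (r' - r)\<bar> \<le> B * (r' - r)\<^sup>2"
proof -
  obtain R' R'' where R: "\<And>r. 0 \<le> r \<Longrightarrow> (R has_real_derivative R' r) (at r within {0..})"
     "\<And>r. 0 \<le> r \<Longrightarrow> (R' has_real_derivative R'' r) (at r within {0..})"
     "continuous_on {0..} R''"
    using assms(1) unfolding C2_on_nonneg_def by blast
  have supp': "R' r = 0" if "1 < r" for r
    by (rule derivative_zero_outside_support[OF R(1) that supp]) (use that in auto)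
  have supp'': "R'' r = 0" if "1 < r" for r
    by (rule derivative_zero_outside_support[OF R(2) that supp']) (use that in auto)
  have c: "continuous_on {0..} R" "continuous_on {0..} R'"
    using R(1,2) by (auto intro!: DERIV_continuous_on)
  obtain B0 where B0: "\<And>r. 0 \<le> r \<Longrightarrow> \<bar>R r\<bar> \<le> B0" using bounded_of_compact_support[OF c(1) supp] by blast
  obtain B1 where B1: "\<And>r. 0 \<le> r \<Longrightarrow> \<bar>R' r\<bar> \<le> B1" using bounded_of_compact_support[OF c(2) supp'] by blast
  obtain B2 where B2: "\<And>r. 0 \<le> r \<Longrightarrow> \<bar>R'' r\<bar> \<le> B2" using bounded_of_compact_support[OF R(3) supp''] by blast
  have lip: "\<bar>R' b - R' a\<bar> \<le> B2 * \<bar>b - a\<bar>" if "0 \<le> a" "0 \<le> b" for a b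
    using field_differentiable_bound[of "{0..}" R' R'' B2 b a] R(2) B2 that by auto
  have B2nn: "0 \<le> B2" using B2[of 0] by linarith
  have taylor: "\<bar>R r' - R r - R' r * (r' - r)\<bar> \<le> B2 * (r' - r)\<^sup>2" if r: "0 \<le> r" "0 \<le> r'" for r r'
  proof -
    have sub: "closed_segment r r' \<subseteq> {0..}" using r by (auto simp: closed_segment_eq_real_ivl)
    have "\<bar>(R r' - R' r * r') - (R r - R' r * r)\<bar> \<le> (B2 * \<bar>r' - r\<bar>) * \<bar>r' - r\<bar>"
    proof (rule field_differentiable_bound[of "closed_segment r r'" _ "\<lambda>x. R' x - R' r", unfolded real_norm_def])
      fix x assume x: "x \<in> closed_segment r r'"
      then have x0: "0 \<le> x" using sub by auto
      have "(R has_real_derivative R' x) (at x within closed_segment r r')"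
        using R(1)[OF x0] sub by (rule DERIV_subset)
      then show "((\<lambda>x. R x - R' r * x) has_real_derivative R' x - R' r) (at x within closed_segment r r')"
        by (auto intro!: derivative_eq_intros)
      have "\<bar>x - r\<bar> \<le> \<bar>r' - r\<bar>" using x by (auto simp: closed_segment_eq_real_ivl split: if_splits)
      then show "\<bar>R' x - R' r\<bar> \<le> B2 * \<bar>r' - r\<bar>"
        using lip[OF r(1) x0] B2nn mult_left_mono order_trans by blast
    qed auto
    moreover have "(R r' - R' r * r') - (R r - R' r * r) = R r' - R r - R' r * (r' - r)"
      by (simp add: algebra_simps)
    moreover have "(B2 * \<bar>r' - r\<bar>) * \<bar>r' - r\<bar> = B2 * (r' - r)\<^sup>2" by (simp add: power2_eq_square)
    ultimately show ?thesis by simp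
  qed
  define B where "B = Max {1, B0, B1, B2}"
  have B: "1 \<le> B" "B0 \<le> B" "B1 \<le> B" "B2 \<le> B" by (auto simp: B_def)
  show thesis
  proof (rule that[OF B(1) c supp'])
    show "\<And>r. 0 \<le> r \<Longrightarrow> \<bar>R r\<bar> \<le> B" "\<And>r. 0 \<le> r \<Longrightarrow> \<bar>R' r\<bar> \<le> B"
      using B0 B1 B by (meson order_trans)+
    show "\<bar>R r' - R r - R' r * (r' - r)\<bar> \<le> B * (r' - r)\<^sup>2" if "0 \<le> r" "0 \<le> r'" for r r'
      using taylor[OF that] B(4) by (meson mult_right_mono order_trans zero_le_power2)
  qed
qed

text \<open>
  A quadratic remainder that is uniform in \<open>y\<close> survives integration against an integrable weight,
  which allows differentiation under the integral sign.
\<close>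
lemma has_derivative_integral_of_quadratic_remainder:
  fixes k :: "'a::euclidean_space \<Rightarrow> 'b \<Rightarrow> real" and G :: "'b \<Rightarrow> 'a"
  assumes E: "\<And>y h. y \<in> space \<mu> \<Longrightarrow> norm h \<le> 1 \<Longrightarrow> \<bar>k (x + h) y - k x y - G y \<bullet> h\<bar> \<le> E * (norm h)\<^sup>2"
    and w: "integrable \<mu> w" and kw: "\<And>x. integrable \<mu> (\<lambda>y. k x y * w y)"
    and Gw: "integrable \<mu> (\<lambda>y. w y *\<^sub>R G y)"
  shows "((\<lambda>x. \<integral>y. k x y * w y \<partial>\<mu>) has_derivative (\<lambda>h. (\<integral>y. w y *\<^sub>R G y \<partial>\<mu>) \<bullet> h)) (at x)"
  unfolding has_derivative_within_alt
proof (intro conjI allI impI)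
  show "bounded_linear (\<lambda>h. (\<integral>y. w y *\<^sub>R G y \<partial>\<mu>) \<bullet> h)" by (rule bounded_linear_inner_right)
  fix e :: real assume e: "0 < e"
  define A where "A = \<bar>E\<bar> * (\<integral>y. \<bar>w y\<bar> \<partial>\<mu>) + 1"
  have A: "0 < A" unfolding A_def by (intro add_nonneg_pos mult_nonneg_nonneg) auto
  let ?K = "\<lambda>x. \<integral>y. k x y * w y \<partial>\<mu>" and ?G = "\<integral>y. w y *\<^sub>R G y \<partial>\<mu>"
  have bound: "\<bar>?K x' - ?K x - ?G \<bullet> (x' - x)\<bar> \<le> A * (norm (x' - x))\<^sup>2" if "norm (x' - x) \<le> 1" for x'
  proof -
    let ?h = "x' - x"
    have Gh: "integrable \<mu> (\<lambda>y. (w y *\<^sub>R G y) \<bullet> ?h)" using Gw by (rule integrable_inner_left)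
    have "?K x' - ?K x - ?G \<bullet> ?h = (\<integral>y. (k x' y * w y - k x y * w y - (w y *\<^sub>R G y) \<bullet> ?h) \<partial>\<mu>)"
    proof -
      have "?G \<bullet> ?h = (\<integral>y. (w y *\<^sub>R G y) \<bullet> ?h \<partial>\<mu>)"
        by (rule integral_inner_left[symmetric]) (rule Gw)
      then show ?thesis using kw Gh by (simp del: inner_scaleR_left)
    qed
    also have "\<bar>\<dots>\<bar> \<le> (\<integral>y. \<bar>k x' y * w y - k x y * w y - (w y *\<^sub>R G y) \<bullet> ?h\<bar> \<partial>\<mu>)"
      by (rule integral_abs_bound)
    also have "\<dots> \<le> (\<integral>y. (\<bar>E\<bar> * (norm ?h)\<^sup>2) * \<bar>w y\<bar> \<partial>\<mu>)"
    proof (rule integral_mono)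
      fix y assume y: "y \<in> space \<mu>"
      have "\<bar>k x' y - k x y - G y \<bullet> ?h\<bar> \<le> E * (norm ?h)\<^sup>2" using E[OF y that] by simp
      also have "\<dots> \<le> \<bar>E\<bar> * (norm ?h)\<^sup>2" by (intro mult_right_mono) auto
      finally have "\<bar>k x' y - k x y - G y \<bullet> ?h\<bar> * \<bar>w y\<bar> \<le> (\<bar>E\<bar> * (norm ?h)\<^sup>2) * \<bar>w y\<bar>"
        by (rule mult_right_mono) simp
      moreover have "k x' y * w y - k x y * w y - (w y *\<^sub>R G y) \<bullet> ?h = (k x' y - k x y - G y \<bullet> ?h) * w y"
        by (simp add: algebra_simps)
      ultimately show "\<bar>k x' y * w y - k x y * w y - (w y *\<^sub>R G y) \<bullet> ?h\<bar> \<le> (\<bar>E\<bar> * (norm ?h)\<^sup>2) * \<bar>w y\<bar>"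
        by (simp add: abs_mult)
    qed (use kw Gh w in auto)
    also have "\<dots> = (A - 1) * (norm ?h)\<^sup>2" by (simp add: A_def)
    also have "\<dots> \<le> A * (norm ?h)\<^sup>2" by (intro mult_right_mono) auto
    finally show ?thesis .
  qed
  show "\<exists>d>0. \<forall>x'\<in>UNIV. norm (x' - x) < d \<longrightarrow> norm (?K x' - ?K x - ?G \<bullet> (x' - x)) \<le> e * norm (x' - x)"
  proof (intro exI[of _ "min 1 (e / A)"] conjI ballI impI)
    show "0 < min 1 (e / A)" using e A by simp
    fix x' assume x': "norm (x' - x) < min 1 (e / A)"
    then have "A * norm (x' - x) \<le> e" using A by (simp add: pos_less_divide_eq mult.commute)
    then have "A * norm (x' - x) * norm (x' - x) \<le> e * norm (x' - x)" by (rule mult_right_mono) simp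
    then show "norm (?K x' - ?K x - ?G \<bullet> (x' - x)) \<le> e * norm (x' - x)"
      using bound[of x'] x' by (simp add: power2_eq_square mult.assoc)
  qed
qed

text \<open>
  Cauchy--Schwarz on a set of measure at most \<open>\<beta>\<close>, obtained by expanding the square of
  \<open>f - l\<close> with \<open>l\<close> the integral divided by \<open>\<beta>\<close>.
\<close>
lemma (in finite_measure) square_integral_indicator_le:
  fixes f :: "'a \<Rightarrow> real"
  assumes A: "A \<in> sets M" "measure M A \<le> \<beta>" "0 < \<beta>"
    and f: "integrable M (\<lambda>x. indicator A x * f x)" "integrable M (\<lambda>x. indicator A x * (f x)\<^sup>2)"
  shows "(\<integral>x. indicator A x * f x \<partial>M)\<^sup>2 \<le> \<beta> * (\<integral>x. indicator A x * (f x)\<^sup>2 \<partial>M)"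
proof -
  define I J l where "I = (\<integral>x. indicator A x * f x \<partial>M)" and "J = (\<integral>x. indicator A x * (f x)\<^sup>2 \<partial>M)"
    and "l = I / \<beta>"
  have iA: "integrable M (\<lambda>x. indicator A x :: real)" using A(1) by (simp add: emeasure_finite less_top[symmetric])
  have "0 \<le> (\<integral>x. indicator A x * (f x - l)\<^sup>2 \<partial>M)" by (rule Bochner_Integration.integral_nonneg) simp
  also have "\<dots> = (\<integral>x. indicator A x * (f x)\<^sup>2 - 2 * l * (indicator A x * f x) + l\<^sup>2 * indicator A x \<partial>M)"
    by (simp add: power2_diff algebra_simps)
  also have "\<dots> = J - 2 * l * I + l\<^sup>2 * measure M A"
    using f iA A(1) by (simp add: I_def J_def)
  also have "\<dots> \<le> J - 2 * l * I + l\<^sup>2 * \<beta>" using A(2) by (intro add_left_mono mult_left_mono) auto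
  also have "\<dots> = J - I\<^sup>2 / \<beta>" using A(3) by (simp add: l_def field_simps power2_eq_square)
  finally show ?thesis using A(3) by (simp add: I_def J_def pos_divide_le_eq mult.commute)
qed

text \<open>
  The function \<open>R'\<close> is the derivative of \<open>R\<close>, in the form of a Taylor expansion with quadratic
  remainder: this is what differentiation under the integral sign uses.
\<close>

locale kernel_smoothing = finite_measure \<mu> for \<mu> :: "'a::euclidean_space measure" +
  fixes p :: "'a \<Rightarrow> real" and R R' :: "real \<Rightarrow> real" and B c1 t :: real
  assumes id_measurable[measurable]: "(\<lambda>x. x) \<in> borel_measurable \<mu>"
    and bounded_space: "bounded (space \<mu>)"
    and p_measurable[measurable]: "p \<in> borel_measurable \<mu>"
    and p_nonneg: "\<And>x. x \<in> space \<mu> \<Longrightarrow> 0 \<le> p x" and p_le: "\<And>x. x \<in> space \<mu> \<Longrightarrow> p x \<le> c1"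
    and c1_nonneg: "0 \<le> c1" and t_pos: "0 < t"
    and R_continuous: "continuous_on {0..} R" and R'_continuous: "continuous_on {0..} R'"
    and R_support: "\<And>r. 1 < r \<Longrightarrow> R r = 0" and R'_support: "\<And>r. 1 < r \<Longrightarrow> R' r = 0"
    and R_bound: "\<And>r. 0 \<le> r \<Longrightarrow> \<bar>R r\<bar> \<le> B" and R'_bound: "\<And>r. 0 \<le> r \<Longrightarrow> \<bar>R' r\<bar> \<le> B"
    and R_taylor: "\<And>r r'. 0 \<le> r \<Longrightarrow> 0 \<le> r' \<Longrightarrow> \<bar>R r' - R r - R' r * (r' - r)\<bar> \<le> B * (r' - r)\<^sup>2"
begin

definition "kern x y = R ((norm (x - y))\<^sup>2 / (4 * t))"

definition "kern_grad x y = (R' ((norm (x - y))\<^sup>2 / (4 * t)) / (2 * t)) *\<^sub>R (x - y)"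

lemma B_nonneg: "0 \<le> B"
  using R_bound[of 0] by linarith

lemma arg_nonneg: "0 \<le> (norm (x - y))\<^sup>2 / (4 * t)"
  using t_pos by simp

lemma arg_gt_1:
  assumes "2 * sqrt t < dist x y"
  shows "1 < (norm (x - y))\<^sup>2 / (4 * t)"
proof -
  have "(2 * sqrt t)\<^sup>2 < (dist x y)\<^sup>2" using assms t_pos by (intro power_strict_mono) auto
  then show ?thesis using t_pos by (simp add: power_mult_distrib dist_norm)
qed

lemma continuous_extension_measurable:
  fixes f :: "real \<Rightarrow> real"
  assumes "continuous_on {0..} f"
  shows "(\<lambda>r. f (max 0 r)) \<in> borel_measurable borel"
  by (intro borel_measurable_continuous_onI continuous_on_compose2[OF assms] continuous_intros) auto

text \<open>
  The profile \<open>R\<close> and its derivative are continuous on the nonnegative reals; cutting off the argument at \<open>0\<close>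
  gives functions that are continuous, hence measurable, on the whole line.
\<close>
lemma kern_max: "kern x y = R (max 0 ((norm (x - y))\<^sup>2 / (4 * t)))"
  and kern_grad_max: "kern_grad x y = (R' (max 0 ((norm (x - y))\<^sup>2 / (4 * t))) / (2 * t)) *\<^sub>R (x - y)"
  using arg_nonneg[of x y] by (auto simp: kern_def kern_grad_def max_absorb2)

lemma kern_measurable2[measurable]: "case_prod kern \<in> borel_measurable (\<mu> \<Otimes>\<^sub>M \<mu>)"
  unfolding kern_max using continuous_extension_measurable[OF R_continuous] by measurable

lemma kern_measurable[measurable]: "kern x \<in> borel_measurable \<mu>"
  unfolding kern_max using continuous_extension_measurable[OF R_continuous] by measurable

lemma kern_grad_measurable[measurable]: "kern_grad x \<in> borel_measurable \<mu>"
  unfolding kern_grad_max using continuous_extension_measurable[OF R'_continuous] by measurable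

lemma abs_kern_le: "\<bar>kern x y\<bar> \<le> B * indicator (cball x (2 * sqrt t)) y"
  using R_bound[OF arg_nonneg, of x y] R_support[OF arg_gt_1, of x y]
  by (auto simp: kern_def indicator_def not_le)

lemma norm_kern_grad_le: "norm (kern_grad x y) \<le> B / sqrt t * indicator (cball x (2 * sqrt t)) y"
proof (cases "dist x y \<le> 2 * sqrt t")
  case True
  have "norm (kern_grad x y) = \<bar>R' ((norm (x - y))\<^sup>2 / (4 * t))\<bar> * (norm (x - y) / (2 * t))"
    using t_pos by (simp add: kern_grad_def)
  also have "\<dots> \<le> B * (2 * sqrt t / (2 * t))"
    using True t_pos B_nonneg
    by (intro mult_mono R'_bound arg_nonneg divide_right_mono) (auto simp: dist_norm)
  also have "2 * sqrt t / (2 * t) = 1 / sqrt t" using t_pos by (simp add: real_div_sqrt field_simps)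
  finally show ?thesis using True by simp
qed (use R'_support[OF arg_gt_1, of x y] in \<open>simp add: kern_grad_def not_le\<close>)

text \<open>
  As a function of \<open>h\<close> the argument of the kernel changes by a linear part, which yields the gradient,
  and by \<open>(norm h)\<^sup>2 / (4 * t)\<close>, which goes into the remainder.
\<close>
lemma kern_quadratic_remainder:
  obtains E where "\<And>y h. y \<in> space \<mu> \<Longrightarrow> norm h \<le> 1 \<Longrightarrow>
    \<bar>kern (x + h) y - kern x y - kern_grad x y \<bullet> h\<bar> \<le> E * (norm h)\<^sup>2"
proof -
  obtain D where D: "\<And>y. y \<in> space \<mu> \<Longrightarrow> norm y \<le> D" using bounded_space unfolding bounded_iff by blast
  define q where "q = (2 * (norm x + D) + 1) / (4 * t)"
  have "\<bar>kern (x + h) y - kern x y - kern_grad x y \<bullet> h\<bar> \<le> (B * q\<^sup>2 + B / (4 * t)) * (norm h)\<^sup>2"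
    if y: "y \<in> space \<mu>" and h: "norm h \<le> 1" for y h
  proof -
    define r r' where "r = (norm (x - y))\<^sup>2 / (4 * t)" and "r' = (norm (x + h - y))\<^sup>2 / (4 * t)"
    have r: "0 \<le> r" "0 \<le> r'" using arg_nonneg by (auto simp: r_def r'_def)
    have diff: "r' - r = (2 * ((x - y) \<bullet> h) + (norm h)\<^sup>2) / (4 * t)"
      by (simp add: r_def r'_def diff_divide_distrib[symmetric] power2_norm_eq_inner algebra_simps inner_commute)
    have "\<bar>2 * ((x - y) \<bullet> h) + (norm h)\<^sup>2\<bar> \<le> 2 * (norm (x - y) * norm h) + (norm h)\<^sup>2"
    proof -
      have "\<bar>2 * a + c\<bar> \<le> 2 * b + c" if "\<bar>a\<bar> \<le> b" "0 \<le> c" for a b c :: real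
        using that by linarith
      then show ?thesis using Cauchy_Schwarz_ineq2[of "x - y" h] by simp
    qed
    also have "\<dots> \<le> 2 * ((norm x + D) * norm h) + 1 * norm h"
      unfolding power2_eq_square using D[OF y] h norm_triangle_ineq4[of x y]
      by (intro add_mono mult_left_mono mult_right_mono) auto
    finally have "\<bar>2 * ((x - y) \<bullet> h) + (norm h)\<^sup>2\<bar> / (4 * t) \<le> (2 * ((norm x + D) * norm h) + 1 * norm h) / (4 * t)"
      using t_pos by (intro divide_right_mono) auto
    then have "\<bar>r' - r\<bar> \<le> q * norm h"
      using t_pos unfolding diff q_def by (simp add: abs_divide algebra_simps)
    then have "(r' - r)\<^sup>2 \<le> (q * norm h)\<^sup>2" using abs_le_square_iff[of "r' - r" "q * norm h"] by simp
    then have 1: "B * (r' - r)\<^sup>2 \<le> B * q\<^sup>2 * (norm h)\<^sup>2"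
      using mult_left_mono[OF _ B_nonneg] by (simp add: power_mult_distrib mult.assoc)
    have "\<bar>R' r * ((norm h)\<^sup>2 / (4 * t))\<bar> \<le> B * ((norm h)\<^sup>2 / (4 * t))"
      unfolding abs_mult using R'_bound[OF r(1)] t_pos by (intro mult_mono) auto
    then have 2: "\<bar>R' r * ((norm h)\<^sup>2 / (4 * t))\<bar> \<le> B / (4 * t) * (norm h)\<^sup>2" by simp
    have "kern (x + h) y - kern x y - kern_grad x y \<bullet> h
        = (R r' - R r - R' r * (r' - r)) + R' r * ((norm h)\<^sup>2 / (4 * t))"
      using t_pos by (simp add: kern_def kern_grad_def diff r_def[symmetric] r'_def[symmetric]) (simp add: field_simps)
    then show ?thesis using R_taylor[OF r] 1 2 unfolding distrib_right by linarith
  qed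
  then show thesis by (rule that)
qed

lemma integrable_kern_mult:
  assumes "integrable \<mu> w"
  shows "integrable \<mu> (\<lambda>y. kern x y * w y)"
proof (rule Bochner_Integration.integrable_bound[OF integrable_mult_right[OF integrable_abs[OF assms], of B]])
  show "AE y in \<mu>. norm (kern x y * w y) \<le> norm (B * \<bar>w y\<bar>)"
  proof (rule AE_I2)
    fix y
    have "\<bar>kern x y\<bar> \<le> B" using abs_kern_le[of x y] B_nonneg by (cases "y \<in> cball x (2 * sqrt t)") auto
    then show "norm (kern x y * w y) \<le> norm (B * \<bar>w y\<bar>)"
      using B_nonneg by (auto simp: abs_mult intro!: mult_right_mono)
  qed
qed (use assms in measurable)

lemma integrable_kern_grad_mult:
  assumes "integrable \<mu> w"
  shows "integrable \<mu> (\<lambda>y. w y *\<^sub>R kern_grad x y)"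
proof (rule Bochner_Integration.integrable_bound[OF integrable_mult_right[OF integrable_abs[OF assms], of "B / sqrt t"]])
  show "AE y in \<mu>. norm (w y *\<^sub>R kern_grad x y) \<le> norm (B / sqrt t * \<bar>w y\<bar>)"
  proof (rule AE_I2)
    fix y
    have Bt: "0 \<le> B / sqrt t" using B_nonneg t_pos by simp
    then have "norm (kern_grad x y) \<le> B / sqrt t"
      using norm_kern_grad_le[of x y] by (cases "y \<in> cball x (2 * sqrt t)") auto
    from mult_left_mono[OF this, of "\<bar>w y\<bar>"]
    show "norm (w y *\<^sub>R kern_grad x y) \<le> norm (B / sqrt t * \<bar>w y\<bar>)"
      using B_nonneg t_pos by (simp add: abs_mult mult.commute)
  qed
qed (use assms in measurable)

lemma has_derivative_kern_integral:
  assumes "integrable \<mu> w"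
  shows "((\<lambda>x. \<integral>y. kern x y * w y \<partial>\<mu>) has_derivative
    (\<lambda>h. (\<integral>y. w y *\<^sub>R kern_grad x y \<partial>\<mu>) \<bullet> h)) (at x)"
proof -
  obtain E where "\<And>y h. y \<in> space \<mu> \<Longrightarrow> norm h \<le> 1 \<Longrightarrow>
    \<bar>kern (x + h) y - kern x y - kern_grad x y \<bullet> h\<bar> \<le> E * (norm h)\<^sup>2"
    using kern_quadratic_remainder by blast
  then show ?thesis
    by (rule has_derivative_integral_of_quadratic_remainder)
      (use assms integrable_kern_mult integrable_kern_grad_mult in auto)
qed

lemma integrable_mult_p:
  assumes "integrable \<mu> w"
  shows "integrable \<mu> (\<lambda>y. w y * p y)"
proof (rule Bochner_Integration.integrable_bound[OF integrable_mult_right[OF integrable_abs[OF assms], of c1]])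
  show "AE y in \<mu>. norm (w y * p y) \<le> norm (c1 * \<bar>w y\<bar>)"
    using p_le p_nonneg c1_nonneg
    by (intro AE_I2) (auto simp: abs_mult mult.commute[of c1] intro!: mult_left_mono)
qed (use assms in measurable)

text \<open>
  The quotient rule is applied to \<open>u\<close>, but in the resulting vector \<open>u\<close> may be replaced by
  \<open>d = u - u x\<close>: the contributions of the constant \<open>u x\<close> to numerator and denominator cancel.
  The two integrals that contain \<open>d\<close> are bounded by multiples of the integral \<open>I\<close> of \<open>\<bar>d\<bar>\<close>
  over the ball of radius \<open>2 * sqrt t\<close>, and the gradient of the weight by a multiple of the volume
  of that ball; Cauchy--Schwarz estimates \<open>I\<^sup>2\<close> by the integral of the squared differences.
\<close>
lemma smoothed_gradient_bound:
  assumes u[measurable]: "u \<in> borel_measurable \<mu>" and u2: "integrable \<mu> (\<lambda>y. (u y)\<^sup>2)"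
    and w: "0 < w" "w \<le> (\<integral>y. kern x y * p y \<partial>\<mu>)"
    and \<beta>: "0 < \<beta>" "measure \<mu> (space \<mu> \<inter> cball x (2 * sqrt t)) \<le> \<beta>"
  obtains g where
    "((\<lambda>x. (\<integral>y. kern x y * (u y * p y) \<partial>\<mu>) / (\<integral>y. kern x y * p y \<partial>\<mu>)) has_derivative (\<lambda>h. g \<bullet> h)) (at x)"
    "(norm g)\<^sup>2 \<le> (c1 * B / (sqrt t * w) * (1 + c1 * B * \<beta> / w))\<^sup>2 * \<beta> *
       (\<integral>y. indicator {..2 * sqrt t} (dist x y) * (u x - u y)\<^sup>2 \<partial>\<mu>)"
proof -
  let ?s = "sqrt t"
  let ?A = "space \<mu> \<inter> cball x (2 * ?s)"
  define d where "d y = u y - u x" for y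
  have d_meas[measurable]: "d \<in> borel_measurable \<mu>" unfolding d_def by measurable
  have ui: "integrable \<mu> u" by (rule square_integrable_imp_integrable[OF u u2])
  have di: "integrable \<mu> d" unfolding d_def using ui by simp
  have d2i: "integrable \<mu> (\<lambda>y. (d y)\<^sup>2)" unfolding d_def power2_diff using ui u2 by simp
  have pi: "integrable \<mu> p" using integrable_mult_p[of "\<lambda>_. 1"] by simp
  note upi = integrable_mult_p[OF ui] and dpi = integrable_mult_p[OF di]
  have A_sets[measurable]: "?A \<in> sets \<mu>"
  proof -
    have "?A = {y \<in> space \<mu>. dist x y \<le> 2 * ?s}" by auto
    then show ?thesis by simp
  qed
  have Adi: "integrable \<mu> (\<lambda>y. indicator ?A y * \<bar>d y\<bar>)"
    using integrable_mult_indicator[OF A_sets integrable_abs[OF di]] by simp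
  have Ad2i: "integrable \<mu> (\<lambda>y. indicator ?A y * \<bar>d y\<bar>\<^sup>2)"
    using integrable_mult_indicator[OF A_sets d2i] by simp
  have Ai: "integrable \<mu> (\<lambda>y. indicator ?A y :: real)"
    using A_sets by (simp add: emeasure_finite less_top[symmetric])
  define I where "I = (\<integral>y. indicator ?A y * \<bar>d y\<bar> \<partial>\<mu>)"
  define N W Nd where "N = (\<integral>y. kern x y * (u y * p y) \<partial>\<mu>)" and "W = (\<integral>y. kern x y * p y \<partial>\<mu>)"
    and "Nd = (\<integral>y. kern x y * (d y * p y) \<partial>\<mu>)"
  define Gu Gp Gd where "Gu = (\<integral>y. (u y * p y) *\<^sub>R kern_grad x y \<partial>\<mu>)"
    and "Gp = (\<integral>y. p y *\<^sub>R kern_grad x y \<partial>\<mu>)" and "Gd = (\<integral>y. (d y * p y) *\<^sub>R kern_grad x y \<partial>\<mu>)"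
  have Nd: "N = Nd + u x * W"
  proof -
    have "Nd = (\<integral>y. kern x y * (u y * p y) - u x * (kern x y * p y) \<partial>\<mu>)"
      by (simp add: Nd_def d_def algebra_simps)
    also have "\<dots> = N - u x * W"
      unfolding N_def W_def using integrable_kern_mult[OF upi] integrable_kern_mult[OF pi] by simp
    finally show ?thesis by simp
  qed
  have Gd: "Gu = Gd + u x *\<^sub>R Gp"
  proof -
    have "Gd = (\<integral>y. (u y * p y) *\<^sub>R kern_grad x y - u x *\<^sub>R (p y *\<^sub>R kern_grad x y) \<partial>\<mu>)"
      by (simp add: Gd_def d_def algebra_simps)
    also have "\<dots> = Gu - u x *\<^sub>R Gp"
      unfolding Gu_def Gp_def
      using integrable_kern_grad_mult[OF upi] integrable_kern_grad_mult[OF pi]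
      by (simp del: scaleR_scaleR)
    finally show ?thesis by simp
  qed
  have W: "w \<le> W" "0 < W" using w by (auto simp: W_def)
  define g where "g = (1 / W) *\<^sub>R Gd - (Nd / W\<^sup>2) *\<^sub>R Gp"
  have der: "((\<lambda>x. (\<integral>y. kern x y * (u y * p y) \<partial>\<mu>) / (\<integral>y. kern x y * p y \<partial>\<mu>)) has_derivative (\<lambda>h. g \<bullet> h)) (at x)"
  proof (rule has_derivative_eq_rhs[OF has_derivative_divide])
    show "((\<lambda>x. \<integral>y. kern x y * (u y * p y) \<partial>\<mu>) has_derivative (\<lambda>h. Gu \<bullet> h)) (at x)"
      unfolding Gu_def by (rule has_derivative_kern_integral[OF upi])
    show "((\<lambda>x. \<integral>y. kern x y * p y \<partial>\<mu>) has_derivative (\<lambda>h. Gp \<bullet> h)) (at x)"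
      unfolding Gp_def by (rule has_derivative_kern_integral[OF pi])
    show "(\<integral>y. kern x y * p y \<partial>\<mu>) \<noteq> 0" using W by (simp add: W_def)
    show "(\<lambda>h. - (\<integral>y. kern x y * (u y * p y) \<partial>\<mu>) *
        (inverse (\<integral>y. kern x y * p y \<partial>\<mu>) * (Gp \<bullet> h) * inverse (\<integral>y. kern x y * p y \<partial>\<mu>))
        + Gu \<bullet> h / (\<integral>y. kern x y * p y \<partial>\<mu>)) = (\<lambda>h. g \<bullet> h)"
      unfolding N_def[symmetric] W_def[symmetric] g_def Nd Gd using W(2)
      by (auto simp: inner_diff_left inner_add_left field_simps power2_eq_square)
  qed
  have c1B: "0 \<le> c1 * B" using c1_nonneg B_nonneg by simp
  have I0: "0 \<le> I" unfolding I_def by (rule Bochner_Integration.integral_nonneg) simp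
  have Nd_le: "\<bar>Nd\<bar> \<le> c1 * B * I"
  proof -
    have "\<bar>Nd\<bar> \<le> (\<integral>y. \<bar>kern x y * (d y * p y)\<bar> \<partial>\<mu>)" unfolding Nd_def by (rule integral_abs_bound)
    also have "\<dots> \<le> (\<integral>y. c1 * B * (indicator ?A y * \<bar>d y\<bar>) \<partial>\<mu>)"
    proof (rule integral_mono)
      fix y assume y: "y \<in> space \<mu>"
      have "\<bar>kern x y * (d y * p y)\<bar> = \<bar>kern x y\<bar> * (\<bar>d y\<bar> * p y)" using p_nonneg[OF y] by (simp add: abs_mult)
      also have "\<dots> \<le> (B * indicator (cball x (2 * ?s)) y) * (\<bar>d y\<bar> * c1)"
        using p_le[OF y] p_nonneg[OF y] B_nonneg by (intro mult_mono abs_kern_le mult_left_mono) auto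
      finally show "\<bar>kern x y * (d y * p y)\<bar> \<le> c1 * B * (indicator ?A y * \<bar>d y\<bar>)"
        using y by (cases "y \<in> cball x (2 * ?s)") (simp_all add: mult_ac)
    qed (use integrable_kern_mult[OF dpi] Adi in auto)
    also have "\<dots> = c1 * B * I" using Adi by (simp add: I_def)
    finally show ?thesis .
  qed
  have Gd_le: "norm Gd \<le> c1 * B / ?s * I"
  proof -
    have "norm Gd \<le> (\<integral>y. norm ((d y * p y) *\<^sub>R kern_grad x y) \<partial>\<mu>)" unfolding Gd_def by (rule integral_norm_bound)
    also have "\<dots> \<le> (\<integral>y. c1 * B / ?s * (indicator ?A y * \<bar>d y\<bar>) \<partial>\<mu>)"
    proof (rule integral_mono)
      fix y assume y: "y \<in> space \<mu>"
      have "norm ((d y * p y) *\<^sub>R kern_grad x y) = norm (kern_grad x y) * (\<bar>d y\<bar> * p y)"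
        using p_nonneg[OF y] by (simp add: abs_mult)
      also have "\<dots> \<le> (B / ?s * indicator (cball x (2 * ?s)) y) * (\<bar>d y\<bar> * c1)"
        using p_le[OF y] p_nonneg[OF y] B_nonneg t_pos
        by (intro mult_mono norm_kern_grad_le mult_left_mono) auto
      finally show "norm ((d y * p y) *\<^sub>R kern_grad x y) \<le> c1 * B / ?s * (indicator ?A y * \<bar>d y\<bar>)"
        using y by (cases "y \<in> cball x (2 * ?s)") (simp_all add: mult_ac)
    qed (use integrable_norm[OF integrable_kern_grad_mult[OF dpi]] Adi in auto)
    also have "\<dots> = c1 * B / ?s * I" using Adi by (simp add: I_def)
    finally show ?thesis .
  qed
  have Gp_le: "norm Gp \<le> c1 * B / ?s * \<beta>"
  proof -
    have "norm Gp \<le> (\<integral>y. norm (p y *\<^sub>R kern_grad x y) \<partial>\<mu>)" unfolding Gp_def by (rule integral_norm_bound)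
    also have "\<dots> \<le> (\<integral>y. c1 * B / ?s * indicator ?A y \<partial>\<mu>)"
    proof (rule integral_mono)
      fix y assume y: "y \<in> space \<mu>"
      have "norm (p y *\<^sub>R kern_grad x y) = norm (kern_grad x y) * p y"
        using p_nonneg[OF y] by simp
      also have "\<dots> \<le> (B / ?s * indicator (cball x (2 * ?s)) y) * c1"
        using p_le[OF y] p_nonneg[OF y] B_nonneg t_pos
        by (intro mult_mono norm_kern_grad_le) auto
      finally show "norm (p y *\<^sub>R kern_grad x y) \<le> c1 * B / ?s * indicator ?A y"
        using y by (cases "y \<in> cball x (2 * ?s)") (simp_all add: mult_ac)
    qed (use integrable_norm[OF integrable_kern_grad_mult[OF pi]] Ai in auto)
    also have "\<dots> = c1 * B / ?s * measure \<mu> ?A" using A_sets by simp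
    also have "\<dots> \<le> c1 * B / ?s * \<beta>" using c1B t_pos \<beta>(2) by (intro mult_left_mono) auto
    finally show ?thesis .
  qed
  let ?\<kappa> = "c1 * B / (?s * w) * (1 + c1 * B * \<beta> / w)"
  have "norm g \<le> norm Gd / W + \<bar>Nd\<bar> * norm Gp / W\<^sup>2"
    unfolding g_def using W(2) norm_triangle_ineq4[of "(1 / W) *\<^sub>R Gd" "(Nd / W\<^sup>2) *\<^sub>R Gp"] by simp
  also have "\<dots> \<le> (c1 * B / ?s * I) / w + (c1 * B * I) * (c1 * B / ?s * \<beta>) / w\<^sup>2"
    using Nd_le Gd_le Gp_le W w(1) c1B I0 t_pos \<beta>(1)
    by (intro add_mono frac_le mult_mono power_mono) auto
  also have "\<dots> = ?\<kappa> * I" using w(1) t_pos by (simp add: field_simps power2_eq_square)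
  finally have "norm g \<le> ?\<kappa> * I" .
  then have "(norm g)\<^sup>2 \<le> (?\<kappa> * I)\<^sup>2" by (rule power_mono) simp
  also have "\<dots> = ?\<kappa>\<^sup>2 * I\<^sup>2" by (rule power_mult_distrib)
  also have "\<dots> \<le> ?\<kappa>\<^sup>2 * (\<beta> * (\<integral>y. indicator ?A y * \<bar>d y\<bar>\<^sup>2 \<partial>\<mu>))"
    unfolding I_def
    by (intro mult_left_mono square_integral_indicator_le[OF A_sets \<beta>(2,1) Adi Ad2i]) simp
  also have "(\<integral>y. indicator ?A y * \<bar>d y\<bar>\<^sup>2 \<partial>\<mu>)
      = (\<integral>y. indicator {..2 * ?s} (dist x y) * (u x - u y)\<^sup>2 \<partial>\<mu>)"
    by (intro Bochner_Integration.integral_cong) (auto simp: indicator_def d_def power2_commute)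
  finally show thesis using that[OF der] by (simp add: mult.assoc)
qed

end

section \<open>Lower bounds from the positivity of the kernel\<close>

context kernel_smoothing
begin

text \<open>
  The constant \<open>7/5\<close> is a rational below \<open>sqrt 2\<close>, so \<open>(7/5)\<^sup>2 / 4\<close> is below the threshold
  \<open>1/2\<close> for the lower bound of the kernel.
\<close>
lemma kern_ge_near:
  assumes "\<And>r. 0 \<le> r \<Longrightarrow> r \<le> 1/2 \<Longrightarrow> \<delta> \<le> R r" and d: "dist x y \<le> 7/5 * sqrt t"
  shows "\<delta> \<le> kern x y"
proof -
  have "(dist x y)\<^sup>2 \<le> (7/5 * sqrt t)\<^sup>2" using d by (intro power_mono) auto
  also have "\<dots> = 49/25 * t" using t_pos by (simp add: power_mult_distrib power2_eq_square)
  finally have "(norm (x - y))\<^sup>2 / (4 * t) \<le> 1/2" using t_pos by (simp add: dist_norm divide_le_eq)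
  then show ?thesis unfolding kern_def by (intro assms(1) arg_nonneg)
qed

lemma weight_lower_bound:
  assumes x: "x \<in> space \<mu>" and c0: "0 \<le> c0" "\<And>y. y \<in> space \<mu> \<Longrightarrow> c0 \<le> p y"
    and R: "\<And>r. 0 \<le> r \<Longrightarrow> 0 \<le> R r" "0 \<le> \<delta>" "\<And>r. 0 \<le> r \<Longrightarrow> r \<le> 1/2 \<Longrightarrow> \<delta> \<le> R r"
    and a: "a \<le> measure \<mu> (space \<mu> \<inter> cball x (7/5 * sqrt t))"
  shows "\<delta> * c0 * a \<le> (\<integral>y. kern x y * p y \<partial>\<mu>)"
proof -
  let ?A = "space \<mu> \<inter> cball x (7/5 * sqrt t)"
  have A[measurable]: "?A \<in> sets \<mu>"
  proof -
    have "?A = {y \<in> space \<mu>. dist x y \<le> 7/5 * sqrt t}" by auto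
    then show ?thesis by simp
  qed
  have pi: "integrable \<mu> p" using integrable_mult_p[of "\<lambda>_. 1"] by simp
  have "\<delta> * c0 * a \<le> \<delta> * c0 * measure \<mu> ?A" using R(2) c0(1) a by (intro mult_left_mono) auto
  also have "\<dots> = (\<integral>y. \<delta> * c0 * indicator ?A y \<partial>\<mu>)" using A by simp
  also have "\<dots> \<le> (\<integral>y. kern x y * p y \<partial>\<mu>)"
  proof (rule integral_mono)
    fix y assume y: "y \<in> space \<mu>"
    show "\<delta> * c0 * indicator ?A y \<le> kern x y * p y"
    proof (cases "y \<in> ?A")
      case True
      then have "\<delta> \<le> kern x y" using kern_ge_near[of \<delta> x y] R(3) by simp
      then show ?thesis using True c0(1) c0(2)[OF y] R(2) by (auto intro!: mult_mono)
    next
      case False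
      then show ?thesis using R(1)[OF arg_nonneg] p_nonneg[OF y] y by (auto simp: kern_def intro!: mult_nonneg_nonneg)
    qed
  qed (use integrable_kern_mult[OF pi] A in \<open>auto simp: emeasure_finite less_top[symmetric]\<close>)
  finally show ?thesis .
qed

lemma energy_lower_bound:
  assumes u[measurable]: "u \<in> borel_measurable \<mu>" and u2: "integrable \<mu> (\<lambda>x. (u x)\<^sup>2)"
    and c0: "0 \<le> c0" "\<And>y. y \<in> space \<mu> \<Longrightarrow> c0 \<le> p y"
    and R: "\<And>r. 0 \<le> r \<Longrightarrow> 0 \<le> R r" "0 \<le> \<delta>" "\<And>r. 0 \<le> r \<Longrightarrow> r \<le> 1/2 \<Longrightarrow> \<delta> \<le> R r"
  shows "\<delta> * c0\<^sup>2 * (\<integral>(x, y). indicator {..7/5 * sqrt t} (dist x y) * (u x - u y)\<^sup>2 \<partial>(\<mu> \<Otimes>\<^sub>M \<mu>))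
    \<le> (\<integral>y. (\<integral>x. R ((norm (x - y))\<^sup>2 / (4 * t)) * (u x - u y)\<^sup>2 * p x * p y \<partial>\<mu>) \<partial>\<mu>)"
proof -
  interpret P: pair_sigma_finite \<mu> \<mu> ..
  let ?F = "\<lambda>x y. kern x y * (u x - u y)\<^sup>2 * p x * p y"
  let ?f = "\<lambda>(x, y). indicator {..7/5 * sqrt t} (dist x y) * (u x - u y)\<^sup>2 :: real"
  have e: "integrable (\<mu> \<Otimes>\<^sub>M \<mu>) (\<lambda>(x, y). (u x - u y)\<^sup>2)"
    by (rule integrable_difference_square[OF finite_measure_axioms u u2])
  have f: "integrable (\<mu> \<Otimes>\<^sub>M \<mu>) ?f"
    by (rule Bochner_Integration.integrable_bound[OF e]) (auto simp: indicator_def)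
  have F: "integrable (\<mu> \<Otimes>\<^sub>M \<mu>) (case_prod ?F)"
  proof (rule Bochner_Integration.integrable_bound[OF integrable_mult_right[OF e, of "B * c1 * c1"]])
    show "AE z in \<mu> \<Otimes>\<^sub>M \<mu>. norm (case_prod ?F z) \<le> norm (B * c1 * c1 * (case z of (x, y) \<Rightarrow> (u x - u y)\<^sup>2))"
    proof (rule AE_I2)
      fix z assume "z \<in> space (\<mu> \<Otimes>\<^sub>M \<mu>)"
      then obtain x y where z: "z = (x, y)" "x \<in> space \<mu>" "y \<in> space \<mu>" by (auto simp: space_pair_measure)
      have "\<bar>kern x y\<bar> \<le> B" using R_bound[OF arg_nonneg] by (simp add: kern_def)
      then have "\<bar>kern x y\<bar> * (p x * p y) \<le> B * (c1 * c1)"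
        using p_nonneg p_le z c1_nonneg B_nonneg by (intro mult_mono) auto
      then have "\<bar>kern x y\<bar> * (p x * p y) * (u x - u y)\<^sup>2 \<le> B * (c1 * c1) * (u x - u y)\<^sup>2"
        by (rule mult_right_mono) simp
      then show "norm (case_prod ?F z) \<le> norm (B * c1 * c1 * (case z of (x, y) \<Rightarrow> (u x - u y)\<^sup>2))"
        using z p_nonneg c1_nonneg B_nonneg by (simp add: abs_mult mult_ac)
    qed
  qed measurable
  have "\<delta> * c0\<^sup>2 * (\<integral>z. ?f z \<partial>(\<mu> \<Otimes>\<^sub>M \<mu>)) = (\<integral>z. \<delta> * c0\<^sup>2 * ?f z \<partial>(\<mu> \<Otimes>\<^sub>M \<mu>))" by simp
  also have "\<dots> \<le> (\<integral>z. case_prod ?F z \<partial>(\<mu> \<Otimes>\<^sub>M \<mu>))"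
  proof (rule integral_mono)
    fix z assume "z \<in> space (\<mu> \<Otimes>\<^sub>M \<mu>)"
    then obtain x y where z: "z = (x, y)" "x \<in> space \<mu>" "y \<in> space \<mu>" by (auto simp: space_pair_measure)
    have k0: "0 \<le> kern x y" using R(1)[OF arg_nonneg] by (simp add: kern_def)
    have pp: "c0 * c0 \<le> p x * p y" using c0 z p_nonneg by (intro mult_mono) auto
    show "\<delta> * c0\<^sup>2 * ?f z \<le> case_prod ?F z"
    proof (cases "dist x y \<le> 7/5 * sqrt t")
      case True
      then have "\<delta> \<le> kern x y" using kern_ge_near[of \<delta> x y] R(3) by simp
      then have "\<delta> * (c0 * c0) \<le> kern x y * (p x * p y)"
        by (rule mult_mono) (use pp k0 R(2) in auto)
      then have "\<delta> * (c0 * c0) * (u x - u y)\<^sup>2 \<le> kern x y * (p x * p y) * (u x - u y)\<^sup>2"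
        by (rule mult_right_mono) simp
      then show ?thesis using True z by (simp add: power2_eq_square[of c0] mult_ac)
    next
      case False
      then show ?thesis using k0 p_nonneg z by simp
    qed
  qed (use f F in auto)
  also have "\<dots> = (\<integral>y. (\<integral>x. ?F x y \<partial>\<mu>) \<partial>\<mu>)" by (rule P.integral_snd[OF F, symmetric])
  finally show ?thesis by (simp add: kern_def)
qed

end

section \<open>The gradient estimate\<close>

text \<open>
  Measurability of \<open>p\<close> for the volume measure comes from this.  Continuity is checked in a chart,
  which suffices because chart images are open in \<open>M\<close>.
\<close>
lemma C1_on_manifold_imp_continuous_on:
  fixes M :: "(real^'d::finite) set"
  assumes sm: "smooth_submanifold_with_boundary TYPE('k::finite) M" and f: "C1_on_manifold TYPE('k) M f"
  shows "continuous_on M f"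
  unfolding continuous_on_eq_continuous_within
proof
  fix x assume x: "x \<in> M"
  obtain i :: 'k and U \<phi> where ch: "local_parametrization M i U \<phi>" "x \<in> \<phi> ` (U \<inter> half_space i)"
    using sm x unfolding smooth_submanifold_with_boundary_def by blast
  let ?D = "U \<inter> half_space i"
  obtain \<psi> where hom: "homeomorphism ?D (\<phi> ` ?D) \<phi> \<psi>" and op: "openin (top_of_set M) (\<phi> ` ?D)"
    using ch(1) unfolding local_parametrization_def by blast
  have "continuous_on ?D (f \<circ> \<phi>)"
  proof -
    obtain D :: "real^'k \<Rightarrow> (real^'k) \<Rightarrow>\<^sub>L real" where
      "\<forall>z\<in>?D. ((f \<circ> \<phi>) has_derivative blinfun_apply (D z)) (at z within ?D)"
      using f ch(1) unfolding C1_on_manifold_def by blast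
    then show ?thesis by (intro has_derivative_continuous_on) blast
  qed
  moreover have "continuous_on (\<phi> ` ?D) \<psi>" "\<psi> ` \<phi> ` ?D \<subseteq> ?D" using hom by (auto simp: homeomorphism_def)
  ultimately have "continuous_on (\<phi> ` ?D) (\<lambda>y. (f \<circ> \<phi>) (\<psi> y))" by (rule continuous_on_compose2)
  then have "continuous_on (\<phi> ` ?D) f"
    by (rule continuous_on_eq) (use hom in \<open>auto simp: homeomorphism_def\<close>)
  then have "continuous (at x within \<phi> ` ?D) f"
    using ch(2) unfolding continuous_on_eq_continuous_within by blast
  moreover obtain T where "open T" "\<phi> ` ?D = M \<inter> T" using op by (metis openin_open)
  moreover from this have "at x within \<phi> ` ?D = at x within M"
    using ch(2) by (intro at_within_nhd[of x T]) auto
  ultimately show "continuous (at x within M) f" by simp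
qed

lemma norm_factor_eq:
  assumes "0 < t"
  shows "norm_factor TYPE('k::finite) t = (4 * pi) powr (- real CARD('k) / 2) / sqrt t ^ CARD('k)"
proof -
  have "t powr (- real CARD('k) / 2) = (t powr (1/2)) powr (- real CARD('k))"
    by (simp add: powr_powr)
  also have "\<dots> = inverse (sqrt t ^ CARD('k))"
    using assms by (simp add: powr_half_sqrt powr_minus powr_realpow)
  finally have "t powr (- real CARD('k) / 2) = inverse (sqrt t ^ CARD('k))" .
  moreover have "norm_factor TYPE('k) t = (4 * pi) powr (- real CARD('k) / 2) * t powr (- real CARD('k) / 2)"
    unfolding norm_factor_def by (rule powr_mult)
  ultimately show ?thesis by (simp only: divide_inverse)
qed

theorem theorem3p8:
  fixes M :: "(real^'d::finite) set"
    and \<mu> :: "(real^'d) measure"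
    and p :: "real^'d \<Rightarrow> real"
    and R :: "real \<Rightarrow> real"
    and c0 c1 \<delta>0 :: real
  assumes M_compact: "compact M"
    and M_smooth: "smooth_submanifold_with_boundary TYPE('k::finite) M"
    and volume: "volume_measure_on TYPE('k) M \<mu>"
    and p_C1: "C1_on_manifold TYPE('k) M p"
    and c0_pos: "0 < c0"
    and p_bounds: "\<forall>x\<in>M. c0 \<le> p x \<and> p x \<le> c1"
    and R_C2: "C2_on_nonneg R"
    and R_nonneg: "\<forall>r\<ge>0. R r \<ge> 0"
    and R_support: "\<forall>r>1. R r = 0"
    and \<delta>0_pos: "0 < \<delta>0"
    and R_lower: "\<forall>r. 0 \<le> r \<and> r \<le> 1/2 \<longrightarrow> R r \<ge> \<delta>0"
  shows "\<exists>C>0. \<exists>t0>0. \<forall>t. 0 < t \<and> t < t0 \<longrightarrow>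
           (\<forall>u :: real^'d \<Rightarrow> real.
              u \<in> borel_measurable \<mu> \<and> integrable \<mu> (\<lambda>x. (u x)\<^sup>2) \<longrightarrow>
                norm_factor TYPE('k) t / t *
                  (\<integral>y. (\<integral>x. R ((norm (x - y))\<^sup>2 / (4 * t)) * (u x - u y)\<^sup>2 * p x * p y \<partial>\<mu>) \<partial>\<mu>)
                \<ge> C * (\<integral>x. (norm (manifold_gradient TYPE('k) M (smoothed_fun TYPE('k) \<mu> R p t u) x))\<^sup>2
                              * p x \<partial>\<mu>))"
proof -
  let ?k = "CARD('k)"
  have fin: "finite_measure \<mu>" by (rule finite_volume[OF M_compact M_smooth volume])
  then interpret finite_measure \<mu> .
  have space: "space \<mu> = M" by (rule space_volume_measure[OF volume])
  have borel: "f \<in> borel_measurable \<mu>" if "continuous_on M f" for f :: "real^'d \<Rightarrow> 'b::topological_space"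
    using borel_measurable_continuous_on_restrict[OF that]
      measurable_cong_sets[OF sets_volume_measure[OF volume] refl] by blast
  have id_meas: "(\<lambda>x. x) \<in> borel_measurable \<mu>" by (intro borel continuous_intros)
  have p_meas: "p \<in> borel_measurable \<mu>" by (intro borel C1_on_manifold_imp_continuous_on[OF M_smooth p_C1])
  obtain r c Cv where reg: "0 < r" "0 < c" "0 < Cv"
    "\<And>x s. x \<in> M \<Longrightarrow> 0 \<le> s \<Longrightarrow> s < r \<Longrightarrow>
       ennreal (c * s ^ ?k) \<le> emeasure \<mu> (M \<inter> cball x s) \<and>
       emeasure \<mu> (M \<inter> cball x s) \<le> ennreal (Cv * s ^ ?k)"
    and mid: "\<And>x y. x \<in> M \<Longrightarrow> y \<in> M \<Longrightarrow> dist x y < r \<Longrightarrow>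
       \<exists>m\<in>M. dist x m \<le> 3/5 * dist x y \<and> dist y m \<le> 3/5 * dist x y"
    using volume_regularity_and_midpoints[OF M_compact M_smooth volume] by blast
  obtain R' B where R: "1 \<le> B" "continuous_on {0..} R" "continuous_on {0..} R'"
    "\<And>r. 1 < r \<Longrightarrow> R' r = 0"
    "\<And>r. 0 \<le> r \<Longrightarrow> \<bar>R r\<bar> \<le> B" "\<And>r. 0 \<le> r \<Longrightarrow> \<bar>R' r\<bar> \<le> B"
    "\<And>r r'. 0 \<le> r \<Longrightarrow> 0 \<le> r' \<Longrightarrow> \<bar>R r' - R r - R' r * (r' - r)\<bar> \<le> B * (r' - r)\<^sup>2"
    using C2_compact_support_bounds[OF R_C2] R_support by metis
  \<comment> \<open>If \<open>M\<close> is empty then \<open>c1\<close> may be negative.\<close>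
  define cp where "cp = max c0 c1"
  have cp: "0 < cp" "\<And>x. x \<in> M \<Longrightarrow> p x \<le> cp" using c0_pos p_bounds by (auto simp: cp_def max_def)
  \<comment> \<open>\<open>w1 * s ^ k\<close> bounds the weight from below, \<open>b1 * s ^ k\<close> bounds the volume of balls of radius
    \<open>2 * s\<close> from above, \<open>\<kappa>\<close> is the constant of the pointwise gradient bound, and \<open>Q\<close> is that of the
    comparison of the energies at the two scales.\<close>
  define w1 where "w1 = \<delta>0 * c0 * (c * (7/5) ^ ?k)"
  define b1 where "b1 = Cv * 2 ^ ?k"
  define \<kappa> where "\<kappa> = cp * B / w1 * (1 + cp * B * b1 / w1)"
  define Q where "Q = 4 * Cv * 7 ^ ?k / c"
  define K where "K = cp * (\<kappa>\<^sup>2 * b1) * Q"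
  define n where "n = (4 * pi) powr (- real ?k / 2)"
  define C where "C = n * \<delta>0 * c0\<^sup>2 / K"
  have w1: "0 < w1" using \<delta>0_pos c0_pos reg by (simp add: w1_def)
  have b1: "0 < b1" using reg by (simp add: b1_def)
  have B: "0 < B" using R(1) by simp
  have "0 < cp * B * b1 / w1" using cp B b1 w1 by simp
  then have \<kappa>: "0 < \<kappa>" unfolding \<kappa>_def using cp(1) B w1 by (intro mult_pos_pos divide_pos_pos) auto
  have Q: "0 < Q" using reg by (simp add: Q_def)
  have K: "0 < K" using cp(1) \<kappa> b1 Q by (simp add: K_def)
  have n: "0 < n" by (simp add: n_def)
  have C: "0 < C" using n \<delta>0_pos c0_pos K by (simp add: C_def)
  show ?thesis
  proof (rule exI[of _ C], intro conjI C, rule exI[of _ "(r / 2)\<^sup>2"], intro conjI allI impI)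
    show "0 < (r / 2)\<^sup>2" using reg(1) by simp
    fix t u assume t: "0 < t \<and> t < (r / 2)\<^sup>2"
      and u: "(u :: real^'d \<Rightarrow> real) \<in> borel_measurable \<mu> \<and> integrable \<mu> (\<lambda>x. (u x)\<^sup>2)"
    define s where "s = sqrt t"
    have s: "0 < s" "2 * s < r" "s\<^sup>2 = t"
    proof -
      show "0 < s" "s\<^sup>2 = t" using t by (auto simp: s_def)
      have "s < r / 2" unfolding s_def using t reg(1) real_less_lsqrt by (metis half_gt_zero less_imp_le)
      then show "2 * s < r" by simp
    qed
    interpret kernel_smoothing \<mu> p R R' B cp t
      by unfold_locales
        (use id_meas p_meas t cp c0_pos p_bounds R R_support M_compact
          in \<open>auto simp: space compact_imp_bounded intro: order_trans less_imp_le\<close>)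
    let ?f = "\<lambda>\<rho> (x, y). indicator {..\<rho>} (dist x y) * (u x - u y)\<^sup>2 :: real"
    define F1 where "F1 = (\<integral>z. ?f (2 * s) z \<partial>(\<mu> \<Otimes>\<^sub>M \<mu>))"
    define F2 where "F2 = (\<integral>z. ?f (7/5 * s) z \<partial>(\<mu> \<Otimes>\<^sub>M \<mu>))"
    have F2: "0 \<le> F2" unfolding F2_def by (rule Bochner_Integration.integral_nonneg) (auto simp: indicator_def)
    have "c * (s/5) ^ ?k * F1 \<le> 4 * (Cv * (7/5 * s) ^ ?k) * F2"
      unfolding F1_def F2_def
    proof (rule chaining[OF fin id_meas])
      fix x assume x: "x \<in> space \<mu>"
      show "ennreal (c * (s/5) ^ ?k) \<le> emeasure \<mu> (space \<mu> \<inter> cball x (s/5))"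
        using reg(4)[of x "s/5"] x s by (simp add: space)
      show "emeasure \<mu> (space \<mu> \<inter> cball x (7/5 * s)) \<le> ennreal (Cv * (7/5 * s) ^ ?k)"
        using reg(4)[of x "7/5 * s"] x s by (simp add: space)
      fix y assume y: "y \<in> space \<mu>" and d: "dist x y \<le> 2 * s"
      then obtain m where "m \<in> M" "dist x m \<le> 3/5 * dist x y" "dist y m \<le> 3/5 * dist x y"
        using mid[of x y] x s by (auto simp: space)
      then show "\<exists>m\<in>space \<mu>. dist x m \<le> 6/5 * s \<and> dist y m \<le> 6/5 * s"
        using d by (intro bexI[of _ m]) (auto simp: space)
    qed (use u reg s in auto)
    also have "\<dots> = c * (s/5) ^ ?k * (Q * F2)"
      using reg by (simp add: Q_def power_divide power_mult_distrib)
    finally have F12: "F1 \<le> Q * F2" using reg s by (subst (asm) mult_le_cancel_left_pos) auto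
    let ?v = "smoothed_fun TYPE('k) \<mu> R p t u"
    have v: "?v = (\<lambda>x. (\<integral>y. kern x y * (u y * p y) \<partial>\<mu>) / (\<integral>y. kern x y * p y \<partial>\<mu>))"
    proof
      fix x
      have "norm_factor TYPE('k) t \<noteq> 0" using t by (simp add: norm_factor_def)
      then show "?v x = (\<integral>y. kern x y * (u y * p y) \<partial>\<mu>) / (\<integral>y. kern x y * p y \<partial>\<mu>)"
        by (simp add: smoothed_fun_def weight_fun_def kern_def mult.assoc)
    qed
    let ?J = "\<lambda>x. \<integral>y. indicator {..2 * s} (dist x y) * (u x - u y)\<^sup>2 \<partial>\<mu>"
    let ?g = "\<lambda>x. norm (manifold_gradient TYPE('k) M ?v x)"
    have pointwise: "(?g x)\<^sup>2 \<le> \<kappa>\<^sup>2 * b1 / (t * s ^ ?k) * ?J x" if x: "x \<in> M" for x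
    proof -
      have w: "w1 * s ^ ?k \<le> (\<integral>y. kern x y * p y \<partial>\<mu>)"
      proof -
        have "c * (7/5 * s) ^ ?k \<le> measure \<mu> (space \<mu> \<inter> cball x (7/5 * sqrt t))"
        proof -
          have "7/5 * s < r" using s by linarith
          then show ?thesis
            using reg(4)[OF x, of "7/5 * s"] s(1) by (simp add: emeasure_eq_measure space s_def)
        qed
        from weight_lower_bound[OF _ _ _ _ _ _ this, of c0 \<delta>0]
        have "\<delta>0 * c0 * (c * (7/5 * s) ^ ?k) \<le> (\<integral>y. kern x y * p y \<partial>\<mu>)"
          using x c0_pos \<delta>0_pos p_bounds R_nonneg R_lower by (simp add: space)
        moreover have "w1 * s ^ ?k = \<delta>0 * c0 * (c * (7/5 * s) ^ ?k)"
          by (simp add: w1_def power_divide power_mult_distrib)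
        ultimately show ?thesis by simp
      qed
      have \<beta>: "measure \<mu> (space \<mu> \<inter> cball x (2 * sqrt t)) \<le> b1 * s ^ ?k"
        using reg(3) reg(4)[OF x, of "2 * s"] s
        by (simp add: emeasure_eq_measure space s_def b1_def power_mult_distrib mult.assoc)
      have pos: "0 < w1 * s ^ ?k" "0 < b1 * s ^ ?k" using w1 b1 s by auto
      obtain g where g: "(?v has_derivative (\<lambda>h. g \<bullet> h)) (at x)"
        "(norm g)\<^sup>2 \<le> (cp * B / (s * (w1 * s ^ ?k)) * (1 + cp * B * (b1 * s ^ ?k) / (w1 * s ^ ?k)))\<^sup>2
           * (b1 * s ^ ?k) * ?J x"
        using smoothed_gradient_bound[OF conjunct1[OF u] conjunct2[OF u] pos(1) w pos(2) \<beta>]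
        unfolding v s_def[symmetric] by blast
      have "cp * B / (s * (w1 * s ^ ?k)) * (1 + cp * B * (b1 * s ^ ?k) / (w1 * s ^ ?k)) = \<kappa> / (s * s ^ ?k)"
        using s(1) w1 by (simp add: \<kappa>_def mult.assoc mult.left_commute)
      moreover have "(\<kappa> / (s * s ^ ?k))\<^sup>2 * (b1 * s ^ ?k) = \<kappa>\<^sup>2 * b1 / (t * s ^ ?k)"
        using s(1) by (simp add: s(3)[symmetric] power2_eq_square)
      ultimately have bound: "(norm g)\<^sup>2 \<le> \<kappa>\<^sup>2 * b1 / (t * s ^ ?k) * ?J x" using g(2) by simp
      have "?g x \<le> norm g"
        by (rule norm_manifold_gradient_le[OF M_smooth x has_derivative_at_withinI[OF g(1)]])
      then have "(?g x)\<^sup>2 \<le> (norm g)\<^sup>2" by (rule power_mono) simp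
      then show ?thesis using bound by (rule order_trans)
    qed
    interpret P: pair_sigma_finite \<mu> \<mu> ..
    have f_int: "integrable (\<mu> \<Otimes>\<^sub>M \<mu>) (?f (2 * s))"
      using u id_meas
      by (intro Bochner_Integration.integrable_bound[OF integrable_difference_square[OF fin, of u]])
        (auto simp: indicator_def)
    \<comment> \<open>If the integrand fails to be integrable, its integral is \<open>0\<close> by convention.\<close>
    have rhs: "(\<integral>x. (?g x)\<^sup>2 * p x \<partial>\<mu>) \<le> cp * (\<kappa>\<^sup>2 * b1) / (t * s ^ ?k) * F1"
    proof (cases "integrable \<mu> (\<lambda>x. (?g x)\<^sup>2 * p x)")
      case True
      have J_int: "integrable \<mu> ?J" by (rule P.integrable_fst[OF f_int])
      have "(\<integral>x. (?g x)\<^sup>2 * p x \<partial>\<mu>) \<le> (\<integral>x. cp * (\<kappa>\<^sup>2 * b1) / (t * s ^ ?k) * ?J x \<partial>\<mu>)"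
      proof (rule integral_mono[OF True integrable_mult_right[OF J_int]])
        fix x assume "x \<in> space \<mu>"
        then have x: "x \<in> M" by (simp add: space)
        have "(?g x)\<^sup>2 * p x \<le> (\<kappa>\<^sup>2 * b1 / (t * s ^ ?k) * ?J x) * cp"
          using pointwise[OF x] cp(2)[OF x] p_bounds x c0_pos
          by (intro mult_mono) (auto intro: order_trans[OF zero_le_power2])
        then show "(?g x)\<^sup>2 * p x \<le> cp * (\<kappa>\<^sup>2 * b1) / (t * s ^ ?k) * ?J x" by (simp add: mult_ac)
      qed
      also have "\<dots> = cp * (\<kappa>\<^sup>2 * b1) / (t * s ^ ?k) * F1"
        using P.integral_fst[OF f_int] by (simp add: F1_def)
      finally show ?thesis .
    next
      case False
      have "0 \<le> F1" unfolding F1_def by (rule Bochner_Integration.integral_nonneg) (auto simp: indicator_def)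
      then show ?thesis using False cp(1) b1 t s(1) by (simp add: not_integrable_integral_eq)
    qed
    let ?E = "\<integral>y. (\<integral>x. R ((norm (x - y))\<^sup>2 / (4 * t)) * (u x - u y)\<^sup>2 * p x * p y \<partial>\<mu>) \<partial>\<mu>"
    have lhs: "\<delta>0 * c0\<^sup>2 * F2 \<le> ?E"
      unfolding F2_def s_def
      by (rule energy_lower_bound) (use u c0_pos p_bounds R_nonneg R_lower \<delta>0_pos in \<open>auto simp: space\<close>)
    have "C * (\<integral>x. (?g x)\<^sup>2 * p x \<partial>\<mu>) \<le> C * (cp * (\<kappa>\<^sup>2 * b1) / (t * s ^ ?k) * F1)"
      using rhs C by (intro mult_left_mono) auto
    also have "\<dots> \<le> C * (cp * (\<kappa>\<^sup>2 * b1) / (t * s ^ ?k) * (Q * F2))"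
      using F12 C cp(1) b1 t s(1) by (intro mult_left_mono) auto
    also have "\<dots> = C * K / (t * s ^ ?k) * F2" by (simp add: K_def)
    also have "\<dots> = n / s ^ ?k / t * (\<delta>0 * c0\<^sup>2 * F2)" using K by (simp add: C_def mult_ac)
    also have "\<dots> \<le> n / s ^ ?k / t * ?E" using lhs n s(1) t by (intro mult_left_mono) auto
    also have "n / s ^ ?k = norm_factor TYPE('k) t" using t by (simp add: norm_factor_eq n_def s_def)
    finally show "C * (\<integral>x. (?g x)\<^sup>2 * p x \<partial>\<mu>) \<le> norm_factor TYPE('k) t / t * ?E" .
  qed
qed

end
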